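(* Let $A$ be a simple unital $\mathrm{C}^*$-algebra containing a non-trivial projection. Let $H$ be a normal subgroup of $\mathrm{U}_A$. Then either $H$ is contained in the center of $\mathrm{U}_A$ or $H$ contains $(\mathrm{U}_A,\mathrm{U}_A)$.
   Context: $\mathrm{U}_A$ denotes the connected component of the identity (in the norm topology) of the unitary group of the unital $\mathrm{C}^*$-algebra $A$. $(\mathrm{U}_A,\mathrm{U}_A)$ is the (algebraic, not closed) commutator subgroup, generated by the elements $uvu^{-1}v^{-1}$ with $u,v\in\mathrm{U}_A$. $H$ is not assumed closed. A non-trivial projection is a projection different from $0$ and $1$. Simple for a $\mathrm{C}^*$-algebra means having no closed two-sided ideals other than $\{0\}$ and itself. *)

theory Defs
  imports "HOL-Analysis.Analysis" "HOL-Algebra.Generated_Groups"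
begin

text \<open>
  Unital $C^*$-algebras as a type class. The class \<open>real_normed_algebra_1\<close> supplies the ring
  structure, the submultiplicative norm and \<open>norm 1 = 1\<close> (which for a $C^*$-norm only excludes the
  zero algebra); \<open>banach\<close> supplies completeness. The distribution has no complex normed spaces,
  so complex scalar multiplication is part of the class.
\<close>

class unital_cstar_algebra = real_normed_algebra_1 + banach +
  fixes scaleC :: "complex \<Rightarrow> 'a \<Rightarrow> 'a"  (infixr \<open>*\<^sub>C\<close> 75)
    and star :: "'a \<Rightarrow> 'a"
  assumes scaleC_of_real: "scaleC (complex_of_real r) x = scaleR r x"
    and scaleC_add_right: "scaleC a (x + y) = scaleC a x + scaleC a y"
    and scaleC_add_left: "scaleC (a + b) x = scaleC a x + scaleC b x"
    and scaleC_scaleC: "scaleC a (scaleC b x) = scaleC (a * b) x"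
    and mult_scaleC_left: "scaleC a x * y = scaleC a (x * y)"
    and mult_scaleC_right: "x * scaleC a y = scaleC a (x * y)"
    and norm_scaleC: "norm (scaleC a x) = cmod a * norm x"
    and star_star: "star (star x) = x"
    and star_add: "star (x + y) = star x + star y"
    and star_scaleC: "star (scaleC a x) = scaleC (cnj a) (star x)"
    and star_mult: "star (x * y) = star y * star x"
    and norm_star_mult_self: "norm (star x * x) = (norm x)\<^sup>2"

definition closed_two_sided_ideal :: "'a::unital_cstar_algebra set \<Rightarrow> bool" where
  "closed_two_sided_ideal I \<longleftrightarrow>
     closed I \<and> 0 \<in> I \<and>
     (\<forall>x\<in>I. \<forall>y\<in>I. x + y \<in> I) \<and>
     (\<forall>c. \<forall>x\<in>I. c *\<^sub>C x \<in> I) \<and>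
     (\<forall>a. \<forall>x\<in>I. a * x \<in> I \<and> x * a \<in> I)"

definition simple_cstar_algebra :: "'a::unital_cstar_algebra itself \<Rightarrow> bool" where
  "simple_cstar_algebra _ \<longleftrightarrow>
     (\<forall>I :: 'a set. closed_two_sided_ideal I \<longrightarrow> I = {0} \<or> I = UNIV)"

definition projection :: "'a::unital_cstar_algebra \<Rightarrow> bool" where
  "projection p \<longleftrightarrow> star p = p \<and> p * p = p"

definition unitaries :: "'a::unital_cstar_algebra set" where
  "unitaries = {u. star u * u = 1 \<and> u * star u = 1}"

definition unitary_component :: "'a::unital_cstar_algebra monoid" where
  "unitary_component =
     \<lparr>carrier = connected_component_set unitaries 1, mult = (*), one = 1\<rparr>"

definition group_center :: "('g, 'm) monoid_scheme \<Rightarrow> 'g set" where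
  "group_center G = {z \<in> carrier G. \<forall>g\<in>carrier G. z \<otimes>\<^bsub>G\<^esub> g = g \<otimes>\<^bsub>G\<^esub> z}"

lemma star_one: "star (1::'a::unital_cstar_algebra) = 1"
  by (metis mult_1_left mult_1_right star_mult star_star)

lemma norm_star: "norm (star x) = norm (x::'a::unital_cstar_algebra)"
proof -
  have le: "norm y \<le> norm (star y)" for y :: 'a
  proof (cases "norm y = 0")
    case False
    have "norm y * norm y \<le> norm (star y) * norm y"
      using norm_mult_ineq[of "star y" y] by (simp add: norm_star_mult_self power2_eq_square)
    with False show ?thesis by (simp add: mult_le_cancel_right)
  qed simp
  from le[of x] le[of "star x"] show ?thesis by (simp add: star_star)
qed

lemma continuous_on_star: "continuous_on S (star :: 'a::unital_cstar_algebra \<Rightarrow> 'a)"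
proof -
  have "dist (star x) (star y) = dist x y" for x y :: 'a
  proof -
    have "star (x - y) + star y = star x" by (simp flip: star_add)
    then have "star x - star y = star (x - y)" by (simp add: algebra_simps)
    then show ?thesis by (simp add: dist_norm norm_star)
  qed
  then show ?thesis by (auto simp: continuous_on_iff)
qed

lemma unitaries_mult: "u \<in> unitaries \<Longrightarrow> v \<in> unitaries \<Longrightarrow> u * v \<in> unitaries"
  unfolding unitaries_def mem_Collect_eq star_mult by (metis mult.assoc mult_1_left)

lemma unitary_component_simps:
  "carrier unitary_component = connected_component_set unitaries 1"
  "x \<otimes>\<^bsub>unitary_component\<^esub> y = x * y"
  "\<one>\<^bsub>unitary_component\<^esub> = 1"
  by (simp_all add: unitary_component_def)

lemma one_in_unitary_component:
  "connected_component unitaries 1 (1::'a::unital_cstar_algebra)"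
  unfolding connected_component_refl_eq by (simp add: unitaries_def star_one)

lemma mult_in_unitary_component:
  fixes u v :: "'a::unital_cstar_algebra"
  assumes u: "connected_component unitaries 1 u" and v: "connected_component unitaries 1 v"
  shows "connected_component unitaries 1 (u * v)"
proof -
  obtain T where T: "connected T" "T \<subseteq> unitaries" "1 \<in> T" "v \<in> T"
    using v unfolding connected_component_def by blast
  have uU: "u \<in> unitaries" using connected_component_in[OF u] by blast
  have "connected ((*) u ` T)"
    by (intro connected_continuous_image continuous_intros T)
  moreover have "(*) u ` T \<subseteq> unitaries" using T uU unitaries_mult by blast
  moreover have "u \<in> (*) u ` T" using T(3) by force
  ultimately have "connected_component unitaries u (u * v)"
    using T(4) unfolding connected_component_def by blast
  with u show ?thesis by (rule connected_component_trans)
qed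

lemma star_in_unitary_component:
  fixes u :: "'a::unital_cstar_algebra"
  assumes u: "connected_component unitaries 1 u"
  shows "connected_component unitaries 1 (star u)"
proof -
  obtain T where T: "connected T" "T \<subseteq> unitaries" "1 \<in> T" "u \<in> T"
    using u unfolding connected_component_def by blast
  have "connected (star ` T)"
    by (intro connected_continuous_image continuous_on_star T)
  moreover have "star ` T \<subseteq> unitaries" using T by (auto simp: unitaries_def star_star)
  moreover have "1 \<in> star ` T" using T(3) star_one by force
  ultimately show ?thesis using T(4) unfolding connected_component_def by blast
qed

lemma group_unitary_component: "group (unitary_component :: 'a::unital_cstar_algebra monoid)"
proof (rule groupI)
  fix x :: 'a assume x: "x \<in> carrier unitary_component"
  then have "x \<in> unitaries"
    using connected_component_in by (auto simp: unitary_component_simps)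
  then have "star x \<otimes>\<^bsub>unitary_component\<^esub> x = \<one>\<^bsub>unitary_component\<^esub>"
    by (simp add: unitary_component_simps unitaries_def)
  moreover have "star x \<in> carrier unitary_component"
    using x star_in_unitary_component by (simp add: unitary_component_simps)
  ultimately show "\<exists>y\<in>carrier unitary_component. y \<otimes>\<^bsub>unitary_component\<^esub> x = \<one>\<^bsub>unitary_component\<^esub>"
    by blast
qed (use one_in_unitary_component mult_in_unitary_component in
      \<open>auto simp: unitary_component_simps mult.assoc simp del: connected_component_refl_eq\<close>)

lemma inv_unitary_component:
  fixes u :: "'a::unital_cstar_algebra"
  assumes "u \<in> carrier unitary_component"
  shows "inv\<^bsub>unitary_component\<^esub> u = star u"
proof (rule group.inv_equality[OF group_unitary_component _ assms])
  have "u \<in> unitaries"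
    using assms connected_component_in by (auto simp: unitary_component_simps)
  then show "star u \<otimes>\<^bsub>unitary_component\<^esub> u = \<one>\<^bsub>unitary_component\<^esub>"
    by (simp add: unitary_component_simps unitaries_def)
  show "star u \<in> carrier unitary_component"
    using assms star_in_unitary_component by (simp add: unitary_component_simps)
qed

end

theory Submission
  imports Defs "HOL-Algebra.Zassenhaus"
begin

text \<open>
Write \<open>G\<close> for the unitary component, and let \<open>H\<close> be a normal subgroup of \<open>G\<close> that is not central. For a
projection \<open>p\<close> let \<open>G\<^sub>p\<close> be the group of all \<open>u \<in> G\<close> with \<open>u p = p u = p\<close>, that is, of the unitaries
that live in the complementary corner. The heart of the proof is that \<open>H G\<^sub>p = G\<close> for every
projection \<open>p \<noteq> 1\<close> (\<open>unitary_component_eq_normal_times_fixing\<close>). For a non-trivial projection \<open>p\<close> this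
applies to both \<open>p\<close> and \<open>1 - p\<close>. So \<open>G\<^sub>p\<close> and \<open>G\<^bsub>1-p\<^esub>\<close> both map onto \<open>G/H\<close>; as they commute element by
element, \<open>G/H\<close> is abelian, which says that \<open>H\<close> contains all commutators.

Since \<open>H\<close> need not be closed, no limit may be taken inside \<open>H\<close>, and \<open>H G\<^sub>p = G\<close> is obtained from
finite products instead. With \<open>c\<close> the Cayley transform, \<open>h\<^sub>k \<in> H\<close>, and bounded linear maps
\<open>w\<^sub>k\<close>, \<open>d\<close> with skew-adjoint values, where \<open>d\<close> takes values in the corner complementary to \<open>p\<close>, the map
\<open>F a = (\<Prod>k. h\<^sub>k c(w\<^sub>k a) h\<^sub>k\<^sup>* c(w\<^sub>k a)\<^sup>*) c(d a)\<close> has values in \<open>H G\<^sub>p\<close>, because every factor but the last is a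
commutator with an element of \<open>H\<close>. Its derivative at \<open>0\<close> is
\<open>a \<mapsto> (\<Sum>k. h\<^sub>k (w\<^sub>k a) h\<^sub>k\<^sup>* - w\<^sub>k a) + d a\<close>. If that derivative is within \<open>1/2\<close> of the identity on skew-adjoint
elements, the contraction principle solves \<open>F a = u\<close> for every unitary \<open>u\<close> close to \<open>1\<close>
(\<open>neighbourhood_of_identity_tangent\<close>). Hence \<open>H G\<^sub>p\<close> is open in the unitaries, and as \<open>G\<close> is connected
it is all of \<open>G\<close>.

What remains is linear and only has to be solved up to a small error in norm, so that here limits are
harmless. Because \<open>h b h\<^sup>* - b = h (b h\<^sup>*) - (b h\<^sup>*) h\<close>, the available derivatives include all maps
\<open>a \<mapsto> h (L a) - (L a) h\<close> with \<open>h \<in> H\<close> and \<open>L\<close> bounded linear. The elements \<open>b\<close> for which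
\<open>a \<mapsto> b (L a) - (L a) b\<close> can be approximated for every \<open>L\<close> form a closed subalgebra that contains \<open>H\<close> and
is normalised by \<open>G\<close>. By an argument of Herstein (\<open>invariant_subalgebra_eq_UNIV\<close>) it is the whole algebra.
With \<open>q = 1 - p\<close>, the identity map is the sum of \<open>a \<mapsto> q a q\<close>, which is an admissible \<open>d\<close>, of the commutator
of \<open>p\<close> with \<open>p a q - q a p\<close>, and of \<open>a \<mapsto> p a p\<close>. For the last map simplicity enters again: \<open>1\<close> lies in
the closed ideal generated by \<open>q\<close>, and
\<open>(p a x q) (q y p) = ((p a x q) (q y p) - (q y p) (p a x q)) + (q y p) (p a x q)\<close> is a commutator plus an element of
the corner of \<open>q\<close> (\<open>approx_tangent_map_identity\<close>).
\<close>

section \<open>Skew-adjoint parts\<close>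

lemma star_scaleR: "star (r *\<^sub>R x) = r *\<^sub>R star (x::'a::unital_cstar_algebra)"
  by (metis complex_cnj_complex_of_real scaleC_of_real star_scaleC)

lemma bounded_linear_star: "bounded_linear (star :: 'a::unital_cstar_algebra \<Rightarrow> 'a)"
  by (rule bounded_linear_intro[where K = 1]) (simp_all add: star_add star_scaleR norm_star)

lemmas star_zero = linear_0[OF bounded_linear.linear[OF bounded_linear_star]]
lemmas star_diff = linear_diff[OF bounded_linear.linear[OF bounded_linear_star]]

lemma bounded_linear_scaleC: "bounded_linear (\<lambda>x. c *\<^sub>C (x::'a::unital_cstar_algebra))"
proof (rule bounded_linear_intro[where K = "cmod c"])
  show "c *\<^sub>C (r *\<^sub>R x) = r *\<^sub>R (c *\<^sub>C x)" for r and x :: 'a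
    by (metis mult.commute scaleC_of_real scaleC_scaleC)
qed (simp_all add: scaleC_add_right norm_scaleC mult.commute)

lemmas scaleC_zero_right = linear_0[OF bounded_linear.linear[OF bounded_linear_scaleC]]
lemmas scaleC_diff_right = linear_diff[OF bounded_linear.linear[OF bounded_linear_scaleC]]

lemma scaleC_minus_left: "(- c) *\<^sub>C x = - (c *\<^sub>C (x::'a::unital_cstar_algebra))"
  using scaleC_add_left[of "- c" c x] scaleC_of_real[of 0 x] by (simp add: eq_neg_iff_add_eq_0)

lemma scaleC_one: "1 *\<^sub>C x = (x::'a::unital_cstar_algebra)"
  by (metis of_real_1 scaleC_of_real scaleR_one)

lemma unitary_group_simps:
  fixes u :: "'a::unital_cstar_algebra"
  assumes "u \<in> unitaries"
  shows "star u * u = 1" "u * star u = 1" "star u * (u * x) = x" "u * (star u * x) = x"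
  using assms by (simp_all add: unitaries_def flip: mult.assoc)

lemma norm_unitary: "u \<in> unitaries \<Longrightarrow> norm u = 1"
  using norm_star_mult_self[of u] norm_ge_zero[of u] by (auto simp: unitaries_def power2_eq_1_iff)

definition skew_part :: "'a::unital_cstar_algebra \<Rightarrow> 'a" where
  "skew_part x = (1/2) *\<^sub>R (x - star x)"

lemma bounded_linear_skew_part: "bounded_linear (skew_part :: 'a::unital_cstar_algebra \<Rightarrow> 'a)"
  unfolding skew_part_def
  by (intro bounded_linear_const_scaleR bounded_linear_sub bounded_linear_ident bounded_linear_star)

lemma star_skew_part: "star (skew_part x) = - skew_part x"
  by (simp add: skew_part_def star_scaleR star_diff star_star flip: scaleR_minus_right)

lemma skew_part_skew: "star x = - x \<Longrightarrow> skew_part x = x"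
  by (simp add: skew_part_def scaleR_2[symmetric])

lemma norm_skew_part_le: "norm (skew_part x) \<le> norm x"
  using norm_triangle_ineq4[of x "star x"] by (simp add: skew_part_def norm_star)

lemma skew_part_conj:
  "skew_part (u * x * star u) = u * skew_part x * star u"
  by (simp add: skew_part_def star_mult star_star algebra_simps)

section \<open>The Cayley transform\<close>

text \<open>
The inverse of \<open>1 - w/2\<close>, written as its Neumann series.
\<close>
definition resolvent :: "'a::unital_cstar_algebra \<Rightarrow> 'a" where
  "resolvent w = (\<Sum>n. ((1/2) *\<^sub>R w) ^ n)"

text \<open>
This is \<open>(1 + w/2) (1 - w/2)\<^sup>-\<^sup>1\<close>. It sends skew-adjoint elements to unitaries, as the exponential does, but
all that is needed about it follows from the geometric series. The factors \<open>1/2\<close> make its derivative at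
\<open>0\<close> the identity.
\<close>
definition cayley :: "'a::unital_cstar_algebra \<Rightarrow> 'a" where
  "cayley w = 2 *\<^sub>R resolvent w - 1"

lemma resolvent_inverse:
  fixes w :: "'a::unital_cstar_algebra"
  assumes "norm w < 2"
  shows "(1 - (1/2) *\<^sub>R w) * resolvent w = 1" "resolvent w * (1 - (1/2) *\<^sub>R w) = 1"
proof -
  define x where "x = (1/2) *\<^sub>R w"
  have s: "summable (\<lambda>n. x ^ n)"
    using assms by (intro complete_algebra_summable_geometric) (simp add: x_def)
  have h: "(\<Sum>n. x ^ Suc n) = resolvent w - 1"
    using suminf_split_head[OF s] by (simp add: resolvent_def x_def)
  have "x * resolvent w = resolvent w - 1"
    using suminf_mult[OF s, of x] h by (simp add: resolvent_def x_def)
  then show "(1 - (1/2) *\<^sub>R w) * resolvent w = 1" by (simp add: x_def[symmetric] algebra_simps)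
  have "resolvent w * x = resolvent w - 1"
    using suminf_mult2[OF s, of x] h by (simp add: resolvent_def x_def power_commutes)
  then show "resolvent w * (1 - (1/2) *\<^sub>R w) = 1" by (simp add: x_def[symmetric] algebra_simps)
qed

lemma norm_resolvent_le:
  fixes w :: "'a::unital_cstar_algebra"
  assumes "norm w \<le> 1"
  shows "norm (resolvent w) \<le> 2" "norm (resolvent w - 1) \<le> norm w"
proof -
  have e: "resolvent w - 1 = ((1/2) *\<^sub>R w) * resolvent w"
    using resolvent_inverse(1)[of w] assms by (simp add: algebra_simps)
  have n: "norm (resolvent w - 1) \<le> norm w / 2 * norm (resolvent w)"
    unfolding e using norm_mult_ineq[of "(1/2) *\<^sub>R w" "resolvent w"] by simp
  have "norm (resolvent w) \<le> norm (resolvent w - 1) + norm (1::'a)"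
    using norm_triangle_ineq[of "resolvent w - 1" 1] by simp
  moreover have "norm w / 2 * norm (resolvent w) \<le> 1/2 * norm (resolvent w)"
    using assms by (intro mult_right_mono) auto
  ultimately show *: "norm (resolvent w) \<le> 2" using n by simp
  have "norm w / 2 * norm (resolvent w) \<le> norm w / 2 * 2"
    using * by (intro mult_left_mono) auto
  with n show "norm (resolvent w - 1) \<le> norm w" by simp
qed

text \<open>
The resolvent identity, written for \<open>cayley\<close>. It yields both the Lipschitz bound and the strict derivative.
\<close>
lemma cayley_diff:
  fixes x y :: "'a::unital_cstar_algebra"
  assumes "norm x < 2" "norm y < 2"
  shows "cayley x - cayley y = resolvent x * (x - y) * resolvent y"
proof -
  have "resolvent x * (x - y) * resolvent y
      = 2 *\<^sub>R (resolvent x * ((1 - (1/2) *\<^sub>R y) - (1 - (1/2) *\<^sub>R x)) * resolvent y)"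
    by (simp add: algebra_simps)
  also have "\<dots> = 2 *\<^sub>R (resolvent x * ((1 - (1/2) *\<^sub>R y) * resolvent y)
                     - (resolvent x * (1 - (1/2) *\<^sub>R x)) * resolvent y)"
    by (simp only: right_diff_distrib left_diff_distrib mult.assoc)
  also have "\<dots> = 2 *\<^sub>R (resolvent x - resolvent y)"
    by (simp only: resolvent_inverse[OF assms(1)] resolvent_inverse[OF assms(2)] mult_1_left mult_1_right)
  finally show ?thesis by (simp add: cayley_def algebra_simps)
qed

lemma cayley_0: "cayley (0::'a::unital_cstar_algebra) = 1"
  using resolvent_inverse(1)[of "0::'a"] by (simp add: cayley_def scaleR_2)

lemma star_resolvent:
  fixes w :: "'a::unital_cstar_algebra"
  assumes "norm w < 2"
  shows "star (resolvent w) = resolvent (star w)"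
proof -
  have n: "norm (star w) < 2" using assms by (simp add: norm_star)
  have "star (resolvent w) * (1 - (1/2) *\<^sub>R star w) = star ((1 - (1/2) *\<^sub>R w) * resolvent w)"
    by (simp add: star_mult star_diff star_one star_scaleR)
  also have "\<dots> = 1" by (simp add: resolvent_inverse(1)[OF assms] star_one)
  finally have "star (resolvent w) * (1 - (1/2) *\<^sub>R star w) * resolvent (star w) = resolvent (star w)"
    by simp
  then show ?thesis by (simp add: mult.assoc resolvent_inverse(1)[OF n])
qed

lemma cayley_unitary:
  fixes w :: "'a::unital_cstar_algebra"
  assumes "norm w < 2" "star w = - w"
  shows "star (cayley w) = cayley (- w)" "cayley w \<in> unitaries"
proof -
  have st: "star (cayley v) = cayley (- v)" if "norm v < 2" "star v = - v" for v :: 'a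
    using star_resolvent[OF that(1)] by (simp add: that(2) cayley_def star_diff star_scaleR star_one)
  show s: "star (cayley w) = cayley (- w)" by (rule st[OF assms])
  have inv: "cayley (- v) * cayley v = 1" if "norm v < 2" for v :: 'a
  proof -
    have "cayley (- v) * (1 + (1/2) *\<^sub>R v)
        = 2 *\<^sub>R (resolvent (- v) * (1 - (1/2) *\<^sub>R (- v))) - (1 + (1/2) *\<^sub>R v)"
      by (simp add: cayley_def left_diff_distrib)
    also have "\<dots> = 2 *\<^sub>R 1 - (1 + (1/2) *\<^sub>R v)"
      using that by (subst resolvent_inverse(2)) auto
    finally have a: "cayley (- v) * (1 + (1/2) *\<^sub>R v) = 1 - (1/2) *\<^sub>R v" by (simp add: scaleR_2)
    have "(1 + (1/2) *\<^sub>R v) * resolvent v = 2 *\<^sub>R resolvent v - (1 - (1/2) *\<^sub>R v) * resolvent v"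
      by (simp add: algebra_simps scaleR_2)
    then have b: "(1 + (1/2) *\<^sub>R v) * resolvent v = cayley v"
      by (simp only: resolvent_inverse(1)[OF that] cayley_def)
    show ?thesis
      using a resolvent_inverse(1)[OF that] by (metis b mult.assoc)
  qed
  show "cayley w \<in> unitaries"
    using inv[of w] inv[of "- w"] assms(1) by (simp add: unitaries_def s)
qed

lemma norm_cayley_diff_le:
  fixes x y :: "'a::unital_cstar_algebra"
  assumes "norm x \<le> 1" "norm y \<le> 1"
  shows "norm (cayley x - cayley y) \<le> 4 * norm (x - y)"
proof -
  have "norm (resolvent x * (x - y) * resolvent y) \<le> norm (resolvent x) * norm (x - y) * norm (resolvent y)"
    by (intro order_trans[OF norm_mult_ineq] mult_right_mono norm_mult_ineq) auto
  also have "\<dots> \<le> 2 * norm (x - y) * 2"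
    using norm_resolvent_le assms by (intro mult_mono) auto
  finally show ?thesis using cayley_diff[of x y] assms by simp
qed

text \<open>
The path \<open>t \<mapsto> cayley (t w)\<close> joins \<open>1\<close> to \<open>cayley w\<close> inside the unitaries.
\<close>
lemma cayley_in_unitary_component:
  fixes w :: "'a::unital_cstar_algebra"
  assumes "norm w \<le> 1" "star w = - w"
  shows "cayley w \<in> carrier unitary_component"
proof -
  have n: "norm (t *\<^sub>R w) \<le> 1" if "t \<in> {0..1}" for t
    using that assms(1) by (simp add: mult_le_one)
  have "4-lipschitz_on {0..1} (\<lambda>t. cayley (t *\<^sub>R w))"
  proof (rule lipschitz_onI)
    fix s t :: real assume st: "s \<in> {0..1}" "t \<in> {0..1}"
    have "dist (cayley (s *\<^sub>R w)) (cayley (t *\<^sub>R w)) \<le> 4 * norm ((s - t) *\<^sub>R w)"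
      using norm_cayley_diff_le[OF n n, OF st] by (simp add: dist_norm scaleR_left_diff_distrib)
    also have "\<dots> \<le> 4 * dist s t"
      using assms(1) by (simp add: dist_norm mult_left_le)
    finally show "dist (cayley (s *\<^sub>R w)) (cayley (t *\<^sub>R w)) \<le> 4 * dist s t" .
  qed simp
  then have "continuous_on {0..1} (\<lambda>t. cayley (t *\<^sub>R w))"
    by (rule lipschitz_on_continuous_on)
  then have c: "connected ((\<lambda>t. cayley (t *\<^sub>R w)) ` {0..1})"
    by (rule connected_continuous_image) simp
  have "(\<lambda>t. cayley (t *\<^sub>R w)) ` {0..1} \<subseteq> unitaries"
  proof (rule image_subsetI)
    fix t :: real assume "t \<in> {0..1}"
    with n[OF this] show "cayley (t *\<^sub>R w) \<in> unitaries"
      by (intro cayley_unitary(2)) (auto simp: star_scaleR assms(2))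
  qed
  moreover have "1 \<in> (\<lambda>t. cayley (t *\<^sub>R w)) ` {0..1}" "cayley w \<in> (\<lambda>t. cayley (t *\<^sub>R w)) ` {0..1}"
    by (force intro: image_eqI[of _ _ 0] simp: cayley_0, force intro: image_eqI[of _ _ 1])
  ultimately show ?thesis
    using c by (auto simp: unitary_component_simps connected_component_def)
qed

section \<open>Strict differentiability at the origin\<close>

text \<open>
The error is compared with \<open>x - y\<close> for two nearby points and not only with \<open>x\<close>: the contraction
principle needs Lipschitz control of the error. The value at the origin is fixed to be \<open>1\<close> so that the
product rule becomes additive.
\<close>
definition strict_deriv_at_0 :: "('a::unital_cstar_algebra \<Rightarrow> 'a) \<Rightarrow> ('a \<Rightarrow> 'a) \<Rightarrow> bool" where
  "strict_deriv_at_0 f L \<longleftrightarrow> f 0 = 1 \<and> bounded_linear L \<and>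
     (\<forall>e>0. \<exists>d>0. \<forall>x y. norm x < d \<longrightarrow> norm y < d \<longrightarrow>
        norm (f x - f y - L (x - y)) \<le> e * norm (x - y))"

lemma strict_derivD:
  assumes "strict_deriv_at_0 f L" "e > 0"
  obtains d where "d > 0"
    "\<And>x y. norm x < d \<Longrightarrow> norm y < d \<Longrightarrow> norm (f x - f y - L (x - y)) \<le> e * norm (x - y)"
  using assms unfolding strict_deriv_at_0_def by metis

lemma strict_deriv_lipschitz:
  assumes "strict_deriv_at_0 f L"
  obtains C d where "C > 0" "d > 0"
    "\<And>x. norm (L x) \<le> C * norm x"
    "\<And>x y. norm x < d \<Longrightarrow> norm y < d \<Longrightarrow> norm (f x - f y) \<le> C * norm (x - y)"
proof -
  have L: "bounded_linear L" using assms by (simp add: strict_deriv_at_0_def)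
  obtain K where K: "K > 0" "\<And>x. norm (L x) \<le> norm x * K"
    using bounded_linear.pos_bounded[OF L] by blast
  obtain d where d: "d > 0" "\<And>x y. norm x < d \<Longrightarrow> norm y < d \<Longrightarrow>
      norm (f x - f y - L (x - y)) \<le> 1 * norm (x - y)"
    using strict_derivD[OF assms zero_less_one] by blast
  have b1: "norm (L x) \<le> (K + 1) * norm x" for x
  proof -
    have "norm (L x) \<le> K * norm x" using K(2)[of x] by (simp add: mult.commute)
    also have "\<dots> \<le> (K + 1) * norm x" by (intro mult_right_mono) auto
    finally show ?thesis .
  qed
  have b2: "norm (f x - f y) \<le> (K + 1) * norm (x - y)" if "norm x < d" "norm y < d" for x y
    using norm_triangle_ineq[of "f x - f y - L (x - y)" "L (x - y)"] d(2)[OF that] K(2)[of "x - y"]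
    by (simp add: algebra_simps)
  show thesis using that[of "K + 1" d] K(1) d(1) b1 b2 by auto
qed

lemma strict_deriv_near_1:
  assumes "strict_deriv_at_0 f L" "e > 0"
  obtains d where "d > 0" "\<And>x. norm x < d \<Longrightarrow> norm (f x - 1) \<le> e"
proof -
  obtain C d where C: "C > 0" "d > 0"
    "\<And>x y. norm x < d \<Longrightarrow> norm y < d \<Longrightarrow> norm (f x - f y) \<le> C * norm (x - y)"
    using strict_deriv_lipschitz[OF assms(1)] by metis
  have f0: "f 0 = 1" using assms(1) by (simp add: strict_deriv_at_0_def)
  have "norm (f x - 1) \<le> e" if "norm x < min d (e / C)" for x
  proof -
    have "norm (f x - 1) \<le> C * norm x" using C(3)[of x 0] C(2) that by (simp add: f0)
    also have "\<dots> \<le> e" using that C(1) by (simp add: field_simps)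
    finally show ?thesis .
  qed
  then show thesis using that[of "min d (e / C)"] C assms(2) by simp
qed

text \<open>
Near the origin both factors are close to \<open>1\<close>, so the increments of a product add up:
\<open>f x g x - f y g y = (f x - f y) g x + f y (g x - g y)\<close>.
\<close>
lemma strict_deriv_mult:
  assumes f: "strict_deriv_at_0 f L" and g: "strict_deriv_at_0 g M"
  shows "strict_deriv_at_0 (\<lambda>x. f x * g x) (\<lambda>x. L x + M x)"
  unfolding strict_deriv_at_0_def
proof (intro conjI allI impI)
  show "f 0 * g 0 = 1" "bounded_linear (\<lambda>x. L x + M x)"
    using f g by (auto simp: strict_deriv_at_0_def intro: bounded_linear_add)
  fix e :: real assume e: "e > 0"
  obtain C where C: "C > 0" "\<And>x. norm (L x) \<le> C * norm x"
    using strict_deriv_lipschitz[OF f] by metis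
  obtain D d2 where D: "D > 0" "d2 > 0"
    "\<And>x y. norm x < d2 \<Longrightarrow> norm y < d2 \<Longrightarrow> norm (g x - g y) \<le> D * norm (x - y)"
    using strict_deriv_lipschitz[OF g] by metis
  \<comment> \<open>The four terms of the decomposition below contribute \<open>2 e'\<close>, \<open>C e'\<close>, \<open>D e'\<close> and \<open>e'\<close>.\<close>
  define e' where "e' = e / (3 + C + D)"
  have e': "e' > 0" using e C D by (simp add: e'_def)
  obtain d3 where d3: "d3 > 0" "\<And>x y. norm x < d3 \<Longrightarrow> norm y < d3 \<Longrightarrow>
      norm (f x - f y - L (x - y)) \<le> e' * norm (x - y)"
    using strict_derivD[OF f e'] by blast
  obtain d4 where d4: "d4 > 0" "\<And>x y. norm x < d4 \<Longrightarrow> norm y < d4 \<Longrightarrow>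
      norm (g x - g y - M (x - y)) \<le> e' * norm (x - y)"
    using strict_derivD[OF g e'] by blast
  obtain d5 where d5: "d5 > 0" "\<And>x. norm x < d5 \<Longrightarrow> norm (f x - 1) \<le> e'"
    using strict_deriv_near_1[OF f e'] by blast
  have m: "min e' 1 > 0" using e' by simp
  obtain d6 where d6: "d6 > 0" "\<And>x. norm x < d6 \<Longrightarrow> norm (g x - 1) \<le> min e' 1"
    using strict_deriv_near_1[OF g m] by blast
  define d where "d = Min {d2, d3, d4, d5, d6}"
  have d0: "d > 0" using C D d3 d4 d5 d6 by (simp add: d_def)
  have "norm (f x * g x - f y * g y - (L (x - y) + M (x - y))) \<le> e * norm (x - y)"
    if "norm x < d" "norm y < d" for x y
  proof -
    let ?n = "norm (x - y)"
    have small: "norm x < d2" "norm y < d2" "norm x < d3" "norm y < d3" "norm x < d4" "norm y < d4"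
       "norm y < d5" "norm x < d6"
      using that by (auto simp: d_def)
    have gx: "norm (g x) \<le> 2"
      using d6(2)[OF small(8)] norm_triangle_ineq[of "g x - 1" 1] by simp
    have "f x * g x - f y * g y - (L (x - y) + M (x - y))
        = (f x - f y - L (x - y)) * g x + L (x - y) * (g x - 1)
          + (f y - 1) * (g x - g y) + (g x - g y - M (x - y))"
      by (simp add: algebra_simps)
    also have "norm \<dots> \<le> norm ((f x - f y - L (x - y)) * g x) + norm (L (x - y) * (g x - 1))
          + norm ((f y - 1) * (g x - g y)) + norm (g x - g y - M (x - y))"
      by (intro order_trans[OF norm_triangle_ineq] add_right_mono order_refl)
    also have "\<dots> \<le> (e' * ?n) * 2 + (C * ?n) * e' + e' * (D * ?n) + e' * ?n"
    proof (intro add_mono)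
      show "norm ((f x - f y - L (x - y)) * g x) \<le> (e' * ?n) * 2"
        using d3(2)[OF small(3,4)] gx e' by (intro order_trans[OF norm_mult_ineq] mult_mono) auto
      show "norm (L (x - y) * (g x - 1)) \<le> (C * ?n) * e'"
        using C(2)[of "x - y"] d6(2)[OF small(8)] C(1)
        by (intro order_trans[OF norm_mult_ineq] mult_mono) auto
      show "norm ((f y - 1) * (g x - g y)) \<le> e' * (D * ?n)"
        using D(3)[OF small(1,2)] d5(2)[OF small(7)] e'
        by (intro order_trans[OF norm_mult_ineq] mult_mono) auto
      show "norm (g x - g y - M (x - y)) \<le> e' * ?n" by (rule d4(2)[OF small(5,6)])
    qed
    also have "\<dots> = e' * (3 + C + D) * ?n" by (simp add: algebra_simps)
    also have "e' * (3 + C + D) = e" using C D by (simp add: e'_def)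
    finally show ?thesis .
  qed
  with d0 show "\<exists>d>0. \<forall>x y. norm x < d \<longrightarrow> norm y < d \<longrightarrow>
      norm (f x * g x - f y * g y - (L (x - y) + M (x - y))) \<le> e * norm (x - y)"
    by blast
qed

lemma norm_triple_mult_le: "norm (a * b * c) \<le> norm a * norm b * norm (c::'a::real_normed_algebra)"
  by (intro order_trans[OF norm_mult_ineq] mult_right_mono norm_mult_ineq) auto

lemma bounded_linear_conj:
  fixes h k :: "'a::real_normed_algebra"
  shows "bounded_linear L \<Longrightarrow> bounded_linear (\<lambda>x. h * L x * k)"
  by (intro bounded_linear_mult_const bounded_linear_const_mult)

lemma strict_deriv_conj:
  assumes f: "strict_deriv_at_0 f L" and "h * k = 1"
  shows "strict_deriv_at_0 (\<lambda>x. h * f x * k) (\<lambda>x. h * L x * k)"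
  unfolding strict_deriv_at_0_def
proof (intro conjI allI impI)
  show "h * f 0 * k = 1" "bounded_linear (\<lambda>x. h * L x * k)"
    using assms by (auto simp: strict_deriv_at_0_def intro: bounded_linear_conj)
  fix e :: real assume e: "e > 0"
  define c where "c = norm h * norm k + 1"
  have c: "c > 0" by (simp add: c_def add_nonneg_pos)
  then obtain d where d: "d > 0" "\<And>x y. norm x < d \<Longrightarrow> norm y < d \<Longrightarrow>
      norm (f x - f y - L (x - y)) \<le> e / c * norm (x - y)"
    using strict_derivD[OF f, of "e / c"] e by (metis divide_pos_pos)
  have "norm (h * f x * k - h * f y * k - h * L (x - y) * k) \<le> e * norm (x - y)"
    if "norm x < d" "norm y < d" for x y
  proof -
    have "h * f x * k - h * f y * k - h * L (x - y) * k = h * (f x - f y - L (x - y)) * k"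
      by (simp add: algebra_simps)
    then have "norm (h * f x * k - h * f y * k - h * L (x - y) * k)
        \<le> norm h * norm (f x - f y - L (x - y)) * norm k"
      using norm_triple_mult_le by metis
    also have "\<dots> = (norm h * norm k) * norm (f x - f y - L (x - y))" by simp
    also have "\<dots> \<le> c * (e / c * norm (x - y))"
      using d(2)[OF that] by (intro mult_mono) (auto simp: c_def)
    finally show ?thesis using c by simp
  qed
  with d(1) show "\<exists>d>0. \<forall>x y. norm x < d \<longrightarrow> norm y < d \<longrightarrow>
      norm (h * f x * k - h * f y * k - h * L (x - y) * k) \<le> e * norm (x - y)"
    by blast
qed

lemma bounded_linear_small:
  assumes "bounded_linear L" "e > 0"
  obtains d where "d > 0" "\<And>x. norm x < d \<Longrightarrow> norm (L x) \<le> e"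
proof -
  obtain K where K: "K > 0" "\<And>x. norm (L x) \<le> norm x * K"
    using bounded_linear.pos_bounded[OF assms(1)] by blast
  have "norm (L x) \<le> e" if "norm x < e / K" for x
  proof -
    have "norm x * K \<le> e" using that K(1) by (simp add: field_simps)
    with K(2)[of x] show ?thesis by linarith
  qed
  then show thesis using that[of "e / K"] K(1) assms(2) by simp
qed

lemma strict_deriv_cayley:
  fixes L :: "'a::unital_cstar_algebra \<Rightarrow> 'a"
  assumes L: "bounded_linear L"
  shows "strict_deriv_at_0 (\<lambda>x. cayley (L x)) L"
  unfolding strict_deriv_at_0_def
proof (intro conjI allI impI)
  show "cayley (L 0) = 1" "bounded_linear L"
    using assms by (auto simp: cayley_0 linear_0[OF bounded_linear.linear[OF L]])
  fix e :: real assume e: "e > 0"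
  obtain K where K: "K > 0" "\<And>x. norm (L x) \<le> norm x * K"
    using bounded_linear.pos_bounded[OF L] by blast
  define e' where "e' = min 1 (e / (3 * K))"
  have "e' > 0" using e K(1) by (simp add: e'_def)
  then obtain d where d: "d > 0" "\<And>x. norm x < d \<Longrightarrow> norm (L x) \<le> e'"
    using bounded_linear_small[OF L] by blast
  have "norm (cayley (L x) - cayley (L y) - L (x - y)) \<le> e * norm (x - y)"
    if "norm x < d" "norm y < d" for x y
  proof -
    have xy: "norm (L x) \<le> 1" "norm (L x) \<le> e / (3 * K)" "norm (L y) \<le> 1" "norm (L y) \<le> e / (3 * K)"
      using d(2)[OF that(1)] d(2)[OF that(2)] by (auto simp: e'_def)
    have D: "L x - L y = L (x - y)"
      by (simp add: linear_diff[OF bounded_linear.linear[OF L]])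
    let ?Rx = "resolvent (L x)" and ?Ry = "resolvent (L y)" and ?n = "norm (L (x - y))"
    have "cayley (L x) - cayley (L y) - L (x - y) = ?Rx * L (x - y) * ?Ry - L (x - y)"
      using cayley_diff[of "L x" "L y"] xy by (simp add: D)
    also have "\<dots> = (?Rx - 1) * L (x - y) * ?Ry + L (x - y) * (?Ry - 1)"
      by (simp add: algebra_simps)
    also have "norm \<dots> \<le> norm (?Rx - 1) * ?n * norm ?Ry + ?n * norm (?Ry - 1)"
      by (intro order_trans[OF norm_triangle_ineq] add_mono norm_triple_mult_le norm_mult_ineq)
    also have "\<dots> \<le> (e / (3 * K)) * ?n * 2 + ?n * (e / (3 * K))"
      using norm_resolvent_le[of "L x"] norm_resolvent_le[of "L y"] xy
      by (intro add_mono mult_mono) (auto intro!: mult_nonneg_nonneg simp: e less_imp_le K(1))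
    also have "\<dots> = e / K * ?n" using K(1) by (simp add: field_simps)
    also have "\<dots> \<le> e / K * (norm (x - y) * K)"
      using K(2)[of "x - y"] e K(1) by (intro mult_left_mono) auto
    also have "\<dots> = e * norm (x - y)" using K(1) by simp
    finally show ?thesis .
  qed
  with d(1) show "\<exists>d>0. \<forall>x y. norm x < d \<longrightarrow> norm y < d \<longrightarrow>
      norm (cayley (L x) - cayley (L y) - L (x - y)) \<le> e * norm (x - y)"
    by blast
qed

section \<open>Tangent maps of a set of unitaries\<close>

text \<open>
The maps \<open>L\<close> that are seen as derivatives of maps into \<open>K\<close>. Only \<open>skew_part \<circ> L\<close> can be such a
derivative when \<open>K\<close> consists of unitaries. Still \<open>L\<close> itself is kept: the expressions
\<open>b (L a) - (L a) b\<close> used below then pass to complex multiples of \<open>b\<close> by absorbing the scalar into \<open>L\<close>.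
\<close>
definition tangent_map :: "'a::unital_cstar_algebra set \<Rightarrow> ('a \<Rightarrow> 'a) \<Rightarrow> bool" where
  "tangent_map K L \<longleftrightarrow> bounded_linear L \<and>
     (\<exists>f. strict_deriv_at_0 f (\<lambda>a. skew_part (L a)) \<and> (\<exists>d>0. \<forall>a. norm a < d \<longrightarrow> f a \<in> K))"

text \<open>
The closure of the tangent maps in operator norm. An approximate solution of the linearised problem
suffices for the contraction principle, so nothing is lost by passing to it.
\<close>
definition approx_tangent_map :: "'a::unital_cstar_algebra set \<Rightarrow> ('a \<Rightarrow> 'a) \<Rightarrow> bool" where
  "approx_tangent_map K L \<longleftrightarrow> bounded_linear L \<and>
     (\<forall>e>0. \<exists>M. tangent_map K M \<and> (\<forall>a. norm (L a - M a) \<le> e * norm a))"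

lemma tangent_mapI:
  assumes "bounded_linear L" "strict_deriv_at_0 f (\<lambda>a. skew_part (L a))"
    "d > 0" "\<And>a. norm a < d \<Longrightarrow> f a \<in> K"
  shows "tangent_map K L"
  using assms unfolding tangent_map_def by blast

text \<open>
Multiply the two maps into \<open>K\<close> pointwise.
\<close>
lemma tangent_map_add:
  assumes "tangent_map K L" "tangent_map K M" and K: "\<And>u v. u \<in> K \<Longrightarrow> v \<in> K \<Longrightarrow> u * v \<in> K"
  shows "tangent_map K (\<lambda>a. L a + M a)"
proof -
  obtain f c where f: "bounded_linear L" "strict_deriv_at_0 f (\<lambda>a. skew_part (L a))"
    "c > 0" "\<And>a. norm a < c \<Longrightarrow> f a \<in> K"
    using assms(1) unfolding tangent_map_def by blast
  obtain g d where g: "bounded_linear M" "strict_deriv_at_0 g (\<lambda>a. skew_part (M a))"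
    "d > 0" "\<And>a. norm a < d \<Longrightarrow> g a \<in> K"
    using assms(2) unfolding tangent_map_def by blast
  show ?thesis
  proof (rule tangent_mapI)
    show "bounded_linear (\<lambda>a. L a + M a)" by (intro bounded_linear_add f g)
    show "strict_deriv_at_0 (\<lambda>a. f a * g a) (\<lambda>a. skew_part (L a + M a))"
      using strict_deriv_mult[OF f(2) g(2)]
      by (simp add: linear_add[OF bounded_linear.linear[OF bounded_linear_skew_part]])
    show "min c d > 0" using f g by simp
  qed (use f g K in auto)
qed

lemma tangent_map_conj:
  assumes "tangent_map K L" and u: "u * star u = 1" and K: "\<And>v. v \<in> K \<Longrightarrow> u * v * star u \<in> K"
  shows "tangent_map K (\<lambda>a. u * L a * star u)"
proof -
  obtain f c where f: "bounded_linear L" "strict_deriv_at_0 f (\<lambda>a. skew_part (L a))"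
    "c > 0" "\<And>a. norm a < c \<Longrightarrow> f a \<in> K"
    using assms(1) unfolding tangent_map_def by blast
  show ?thesis
  proof (rule tangent_mapI)
    show "bounded_linear (\<lambda>a. u * L a * star u)" by (intro bounded_linear_conj f)
    show "strict_deriv_at_0 (\<lambda>a. u * f a * star u) (\<lambda>a. skew_part (u * L a * star u))"
      using strict_deriv_conj[OF f(2) u] by (simp add: skew_part_conj)
  qed (use f K in auto)
qed

lemma tangent_map_mono: "tangent_map K L \<Longrightarrow> K \<subseteq> K' \<Longrightarrow> tangent_map K' L"
  unfolding tangent_map_def by blast

lemma approx_tangent_map_mono: "approx_tangent_map K L \<Longrightarrow> K \<subseteq> K' \<Longrightarrow> approx_tangent_map K' L"
  unfolding approx_tangent_map_def by (meson tangent_map_mono)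

lemma tangent_map_imp_approx: "tangent_map K L \<Longrightarrow> approx_tangent_map K L"
  unfolding approx_tangent_map_def
  by (metis diff_self mult_nonneg_nonneg norm_ge_zero norm_zero less_imp_le tangent_map_def)

lemma approx_tangent_map_add:
  assumes L: "approx_tangent_map K L" and M: "approx_tangent_map K M"
    and K: "\<And>u v. u \<in> K \<Longrightarrow> v \<in> K \<Longrightarrow> u * v \<in> K"
  shows "approx_tangent_map K (\<lambda>a. L a + M a)"
  unfolding approx_tangent_map_def
proof (intro conjI allI impI)
  show "bounded_linear (\<lambda>a. L a + M a)"
    using L M by (auto simp: approx_tangent_map_def intro: bounded_linear_add)
  fix e :: real assume e: "e > 0"
  then have e2: "e / 2 > 0" by simp
  obtain L' where L': "tangent_map K L'" "\<And>a. norm (L a - L' a) \<le> e / 2 * norm a"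
    using L e2 unfolding approx_tangent_map_def by blast
  obtain M' where M': "tangent_map K M'" "\<And>a. norm (M a - M' a) \<le> e / 2 * norm a"
    using M e2 unfolding approx_tangent_map_def by blast
  have "norm (L a + M a - (L' a + M' a)) \<le> e * norm a" for a
    using norm_triangle_ineq[of "L a - L' a" "M a - M' a"] L'(2)[of a] M'(2)[of a]
    by (simp add: algebra_simps)
  then show "\<exists>N. tangent_map K N \<and> (\<forall>a. norm (L a + M a - N a) \<le> e * norm a)"
    using tangent_map_add[OF L'(1) M'(1) K] by blast
qed

lemma approx_tangent_map_closed:
  assumes L: "bounded_linear L"
    and ap: "\<And>e. e > 0 \<Longrightarrow> \<exists>M. approx_tangent_map K M \<and> (\<forall>a. norm (L a - M a) \<le> e * norm a)"
  shows "approx_tangent_map K L"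
  unfolding approx_tangent_map_def
proof (intro conjI allI impI L)
  fix e :: real assume e: "e > 0"
  then have e2: "e / 2 > 0" by simp
  obtain M where M: "approx_tangent_map K M" "\<And>a. norm (L a - M a) \<le> e / 2 * norm a"
    using ap[OF e2] by blast
  obtain N where N: "tangent_map K N" "\<And>a. norm (M a - N a) \<le> e / 2 * norm a"
    using M(1) e2 unfolding approx_tangent_map_def by blast
  have "norm (L a - N a) \<le> e * norm a" for a
    using norm_triangle_ineq[of "L a - M a" "M a - N a"] M(2)[of a] N(2)[of a]
    by (simp add: algebra_simps)
  with N(1) show "\<exists>N. tangent_map K N \<and> (\<forall>a. norm (L a - N a) \<le> e * norm a)" by blast
qed

lemma approx_tangent_map_conj:
  assumes L: "approx_tangent_map K L" and u: "u \<in> unitaries"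
    and K: "\<And>v. v \<in> K \<Longrightarrow> u * v * star u \<in> K"
  shows "approx_tangent_map K (\<lambda>a. u * L a * star u)"
  unfolding approx_tangent_map_def
proof (intro conjI allI impI)
  have uu: "u * star u = 1" using u by (simp add: unitaries_def)
  note nu = norm_unitary[OF u]
  show "bounded_linear (\<lambda>a. u * L a * star u)"
    using L by (auto simp: approx_tangent_map_def intro: bounded_linear_conj)
  fix e :: real assume "e > 0"
  then obtain M where M: "tangent_map K M" "\<And>a. norm (L a - M a) \<le> e * norm a"
    using L unfolding approx_tangent_map_def by blast
  have "norm (u * L a * star u - u * M a * star u) \<le> e * norm a" for a
  proof -
    have "u * L a * star u - u * M a * star u = u * (L a - M a) * star u"
      by (simp add: algebra_simps)
    then show ?thesis
      using norm_triple_mult_le[of u "L a - M a" "star u"] M(2)[of a] nu by (simp add: norm_star)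
  qed
  then show "\<exists>M. tangent_map K M \<and> (\<forall>a. norm (u * L a * star u - M a) \<le> e * norm a)"
    using tangent_map_conj[OF M(1) uu K] by blast
qed

section \<open>Closed subalgebras normalised by the unitary component\<close>

text \<open>
Conjugating \<open>b\<close> along the path \<open>t \<mapsto> cayley (t w)\<close> and differentiating at \<open>t = 0\<close> gives the commutator
\<open>w b - b w\<close>. It follows that closed linear subspaces normalised by the unitary component are Lie ideals.
\<close>
lemma unitary_component_conj_tendsto:
  fixes w b :: "'a::unital_cstar_algebra"
  assumes w: "star w = - w"
  defines "c \<equiv> \<lambda>t. cayley (t *\<^sub>R w)"
  shows "((\<lambda>t. (1/t) *\<^sub>R (c t * b * star (c t) - b)) \<longlongrightarrow> w * b - b * w) (at_right 0)"
    and "\<forall>\<^sub>F t in at_right 0. c t \<in> carrier unitary_component"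
proof -
  have n0: "((\<lambda>t. norm (t *\<^sub>R w)) \<longlongrightarrow> 0) (at_right 0)"
    by (rule tendsto_eq_intros refl tendsto_ident_at | simp)+
  have ev: "\<forall>\<^sub>F t in at_right 0. norm (t *\<^sub>R w) \<le> 1"
    using order_tendstoD(2)[OF n0 zero_less_one] by eventually_elim simp
  show "\<forall>\<^sub>F t in at_right 0. c t \<in> carrier unitary_component"
    using ev
  proof eventually_elim
    case (elim t)
    then show ?case unfolding c_def by (rule cayley_in_unitary_component) (simp add: star_scaleR w)
  qed
  have "((\<lambda>t. resolvent (t *\<^sub>R w) - 1) \<longlongrightarrow> 0) (at_right 0)"
  proof (rule Lim_null_comparison[OF _ n0])
    show "\<forall>\<^sub>F t in at_right 0. norm (resolvent (t *\<^sub>R w) - 1) \<le> norm (t *\<^sub>R w)"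
      using ev by eventually_elim (rule norm_resolvent_le(2))
  qed
  then have R: "((\<lambda>t. resolvent (t *\<^sub>R w)) \<longlongrightarrow> 1) (at_right 0)"
    by (rule LIM_zero_cancel)
  have "((\<lambda>t. 2 *\<^sub>R resolvent (t *\<^sub>R w) - 1) \<longlongrightarrow> 2 *\<^sub>R 1 - 1) (at_right 0)"
    by (intro tendsto_intros R)
  then have "(c \<longlongrightarrow> 1) (at_right 0)" by (simp add: c_def cayley_def[abs_def] scaleR_2)
  then have S: "((\<lambda>t. star (c t)) \<longlongrightarrow> 1) (at_right 0)"
    using bounded_linear.tendsto[OF bounded_linear_star] star_one by metis
  have "((\<lambda>t. (resolvent (t *\<^sub>R w) * w * b - b * (resolvent (t *\<^sub>R w) * w)) * star (c t))
          \<longlongrightarrow> (1 * w * b - b * (1 * w)) * 1) (at_right 0)"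
    by (intro tendsto_intros R S)
  moreover have "\<forall>\<^sub>F t in at_right 0. (1/t) *\<^sub>R (c t * b * star (c t) - b)
      = (resolvent (t *\<^sub>R w) * w * b - b * (resolvent (t *\<^sub>R w) * w)) * star (c t)"
    using ev eventually_at_right_less[of "0::real"]
  proof eventually_elim
    case (elim t)
    have u: "c t * star (c t) = 1"
      using cayley_unitary(2)[of "t *\<^sub>R w"] elim by (simp add: c_def star_scaleR w unitaries_def)
    have r1: "resolvent 0 = (1::'a)" using resolvent_inverse(1)[of "0::'a"] by simp
    have c1: "c t - 1 = t *\<^sub>R (resolvent (t *\<^sub>R w) * w)"
      using cayley_diff[of "t *\<^sub>R w" 0] elim by (simp add: c_def cayley_0 r1)
    have "c t * b * star (c t) - b = ((c t - 1) * b - b * (c t - 1)) * star (c t)"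
      by (simp add: algebra_simps u)
    also have "\<dots> = t *\<^sub>R ((resolvent (t *\<^sub>R w) * w * b - b * (resolvent (t *\<^sub>R w) * w)) * star (c t))"
      by (simp add: c1 scaleR_right_diff_distrib left_diff_distrib)
    finally show ?case using elim by simp
  qed
  ultimately show "((\<lambda>t. (1/t) *\<^sub>R (c t * b * star (c t) - b)) \<longlongrightarrow> w * b - b * w) (at_right 0)"
    by (simp add: tendsto_cong)
qed

text \<open>
Every element is a complex combination of skew-adjoint ones, so statements that are complex linear in \<open>a\<close>
reduce to skew-adjoint \<open>a\<close>.
\<close>
lemma skew_decomposition: "a = skew_part a + (- \<i>) *\<^sub>C skew_part (\<i> *\<^sub>C a)"
proof -
  have "(- \<i>) *\<^sub>C skew_part (\<i> *\<^sub>C a) = (1/2) *\<^sub>R (a + star a)"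
  proof -
    have "skew_part (\<i> *\<^sub>C a) = \<i> *\<^sub>C ((1/2) *\<^sub>R (a + star a))"
      by (simp add: skew_part_def star_scaleC scaleC_minus_left scaleC_add_right scaleC_scaleC
          mult.commute flip: scaleC_of_real)
    then show ?thesis by (simp add: scaleC_scaleC scaleC_one)
  qed
  then show ?thesis
    by (simp add: skew_part_def flip: scaleR_right_distrib)
qed

text \<open>
The argument of Herstein for Lie ideals of simple rings. Invariance makes the closed algebra \<open>B\<close> a Lie
ideal. If \<open>z = x y - y x\<close> with \<open>x, y \<in> B\<close>, then \<open>x (y r) - (y r) x = z r + y (x r - r x)\<close> shows
\<open>z r \<in> B\<close> for all \<open>r\<close>, and a further commutator shows that the two-sided ideal of \<open>z\<close> lies in \<open>B\<close>.
By simplicity either \<open>B\<close> is everything or \<open>B\<close> is commutative. In the second case the derivation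
\<open>\<delta> x = b x - x b\<close> satisfies \<open>\<delta> \<circ> \<delta> = 0\<close>; the Leibniz rule turns this into \<open>\<delta> x \<delta> y = 0\<close>, and for
self-adjoint \<open>b\<close> the \<open>C\<^sup>*\<close>-identity gives \<open>\<delta> = 0\<close>, so \<open>b\<close> would be central.
\<close>
lemma invariant_subalgebra_eq_UNIV:
  fixes B :: "'a::unital_cstar_algebra set"
  assumes simple: "simple_cstar_algebra TYPE('a)"
    and cl: "closed B"
    and add: "\<And>x y. x \<in> B \<Longrightarrow> y \<in> B \<Longrightarrow> x + y \<in> B"
    and scale: "\<And>c x. x \<in> B \<Longrightarrow> c *\<^sub>C x \<in> B"
    and mult: "\<And>x y. x \<in> B \<Longrightarrow> y \<in> B \<Longrightarrow> x * y \<in> B"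
    and invar: "\<And>u x. u \<in> carrier unitary_component \<Longrightarrow> x \<in> B \<Longrightarrow> u * x * star u \<in> B"
    and b: "b \<in> B" "star b = b" and noncentral: "b * a \<noteq> a * b"
  shows "B = UNIV"
proof -
  have neg: "- x \<in> B" if "x \<in> B" for x
    using scale[OF that, of "- 1"] by (simp add: scaleC_minus_left scaleC_one)
  have diff: "x - y \<in> B" if "x \<in> B" "y \<in> B" for x y
    using add[OF that(1) neg[OF that(2)]] by simp
  have zero: "0 \<in> B" using diff[OF b(1) b(1)] by simp
  have lie_skew: "w * x - x * w \<in> B" if w: "star w = - w" and x: "x \<in> B" for w x
  proof (rule Lim_in_closed_set[OF cl _ _ unitary_component_conj_tendsto(1)[OF w]])
    show "\<forall>\<^sub>F t in at_right 0. (1/t) *\<^sub>R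
        (cayley (t *\<^sub>R w) * x * star (cayley (t *\<^sub>R w)) - x) \<in> B"
      using unitary_component_conj_tendsto(2)[OF w]
    proof eventually_elim
      case (elim t)
      show ?case
        by (subst scaleC_of_real[symmetric]) (rule scale[OF diff[OF invar[OF elim x] x]])
    qed
  qed simp
  have lie: "y * x - x * y \<in> B" if x: "x \<in> B" for x y
  proof -
    let ?v = "skew_part y" and ?w = "skew_part (\<i> *\<^sub>C y)"
    have "y * x - x * y = (?v * x - x * ?v) + (- \<i>) *\<^sub>C (?w * x - x * ?w)"
    proof -
      have "(- \<i>) *\<^sub>C (?w * x - x * ?w) = ((- \<i>) *\<^sub>C ?w) * x - x * ((- \<i>) *\<^sub>C ?w)"
        by (simp add: mult_scaleC_left mult_scaleC_right
            scaleC_diff_right)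
      then have "(?v * x - x * ?v) + (- \<i>) *\<^sub>C (?w * x - x * ?w)
          = (?v + (- \<i>) *\<^sub>C ?w) * x - x * (?v + (- \<i>) *\<^sub>C ?w)"
        by (simp add: algebra_simps)
      then show ?thesis by (simp flip: skew_decomposition)
    qed
    then show ?thesis
      by (metis add[OF lie_skew[OF star_skew_part x] scale[OF lie_skew[OF star_skew_part x]]])
  qed
  \<comment> \<open>The largest two-sided ideal that is contained in \<open>B\<close>.\<close>
  define J where "J = {z. \<forall>x y. x * z * y \<in> B}"
  have "closed_two_sided_ideal J"
    unfolding closed_two_sided_ideal_def
  proof (intro conjI ballI allI)
    have "J = (\<Inter>x y. (\<lambda>z. x * z * y) -` B)" by (auto simp: J_def)
    moreover have "closed ((\<lambda>z. x * z * y) -` B)" for x y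
      by (intro continuous_closed_vimage[OF cl] continuous_intros)
    ultimately show "closed J" by (simp add: closed_INT)
    show "0 \<in> J" by (simp add: J_def zero)
    show "z + z' \<in> J" if "z \<in> J" "z' \<in> J" for z z'
      using that add by (simp add: J_def distrib_left distrib_right)
    show "c *\<^sub>C z \<in> J" if "z \<in> J" for c z
      using that scale by (simp add: J_def mult_scaleC_left mult_scaleC_right)
    show "r * z \<in> J" if "z \<in> J" for r z
      using that by (simp add: J_def flip: mult.assoc)
    show "z * r \<in> J" if "z \<in> J" for r z
      using that by (simp add: J_def mult.assoc)
  qed
  then consider "J = {0}" | "J = UNIV" using simple unfolding simple_cstar_algebra_def by blast
  then show ?thesis
  proof cases
    case 1
    have comm: "x * y = y * x" if "x \<in> B" "y \<in> B" for x y
    proof -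
      define z where "z = x * y - y * x"
      \<comment> \<open>The right ideal of the commutator \<open>z\<close> is already contained in \<open>B\<close>.\<close>
    have zr: "z * r \<in> B" for r
      proof -
        have "z * r = (x * (y * r) - y * r * x) - y * (x * r - r * x)"
          by (simp add: z_def algebra_simps)
        moreover have "x * (y * r) - y * r * x \<in> B" "x * r - r * x \<in> B"
          using neg[OF lie[OF \<open>x \<in> B\<close>, of "y * r"]] neg[OF lie[OF \<open>x \<in> B\<close>, of r]] by simp_all
        ultimately show ?thesis by (simp add: diff[OF _ mult[OF that(2)]])
      qed
      have "z \<in> J" unfolding J_def
      proof (intro CollectI allI)
        fix r s
        have "r * z * s = (r * (z * s) - z * s * r) + z * (s * r)" by (simp add: algebra_simps)
        then show "r * z * s \<in> B" by (simp only: add[OF lie[OF zr] zr])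
      qed
      with 1 show ?thesis by (simp add: z_def)
    qed
    define \<delta> where "\<delta> x = b * x - x * b" for x
    have \<delta>B: "\<delta> x \<in> B" for x using neg[OF lie[OF b(1), of x]] by (simp add: \<delta>_def)
    have "\<delta> (\<delta> x) = 0" for x using comm[OF b(1) \<delta>B] by (simp add: \<delta>_def[of "\<delta> x"])
    moreover have "\<delta> (\<delta> (x * y)) = \<delta> (\<delta> x) * y + 2 *\<^sub>R (\<delta> x * \<delta> y) + x * \<delta> (\<delta> y)" for x y
      by (simp add: \<delta>_def algebra_simps scaleR_2)
    ultimately have "2 *\<^sub>R (\<delta> x * \<delta> y) = 0" for x y
      by (simp only: mult_zero_left mult_zero_right add_0_left add_0_right)
    then have "\<delta> x * \<delta> y = 0" for x y by simp
    moreover have "star (\<delta> a) = - \<delta> (star a)"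
      by (simp add: \<delta>_def star_diff star_mult b(2))
    ultimately have "star (\<delta> a) * \<delta> a = 0" by simp
    then have "\<delta> a = 0" using norm_star_mult_self[of "\<delta> a"] by simp
    with noncentral show ?thesis by (simp add: \<delta>_def)
  next
    case 2
    then have "1 \<in> J" by simp
    then have "1 * 1 * y \<in> B" for y unfolding J_def by blast
    then show ?thesis by auto
  qed
qed

section \<open>Tangent maps of a noncentral normal subgroup\<close>

lemma normal_unitary_facts:
  fixes H :: "'a::unital_cstar_algebra set"
  assumes "H \<lhd> unitary_component"
  shows "h \<in> H \<Longrightarrow> h \<in> carrier unitary_component" "h \<in> H \<Longrightarrow> star h \<in> H"
    "h \<in> H \<Longrightarrow> k \<in> H \<Longrightarrow> h * k \<in> H" "1 \<in> H"
    "u \<in> carrier unitary_component \<Longrightarrow> h \<in> H \<Longrightarrow> u * h * star u \<in> H"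
proof -
  have sg: "subgroup H unitary_component" using assms normal_imp_subgroup by blast
  show c: "h \<in> carrier unitary_component" if "h \<in> H" for h using sg that subgroup.mem_carrier by fast
  show "star h \<in> H" if "h \<in> H"
    using subgroup.m_inv_closed[OF sg that] inv_unitary_component[OF c[OF that]] by simp
  show "h \<in> H \<Longrightarrow> k \<in> H \<Longrightarrow> h * k \<in> H"
    using subgroup.m_closed[OF sg] by (simp add: unitary_component_simps)
  show "1 \<in> H" using subgroup.one_closed[OF sg] by (simp add: unitary_component_simps)
  show "u * h * star u \<in> H" if "u \<in> carrier unitary_component" "h \<in> H"
    using normal.inv_op_closed2[OF assms that] inv_unitary_component[OF that(1)]
    by (simp add: unitary_component_def)
qed

lemma unitary_component_imp_unitary:
  "u \<in> carrier unitary_component \<Longrightarrow> u \<in> unitaries"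
  using connected_component_in by (auto simp: unitary_component_simps)

text \<open>
The commutator \<open>h c(w) h\<^sup>* c(w)\<^sup>*\<close> lies in \<open>H\<close> and has derivative \<open>h w h\<^sup>* - w\<close>. Taking for \<open>w\<close> the skew
part of \<open>L a h\<close> produces the skew part of \<open>h (L a) - (L a) h\<close>.
\<close>
lemma tangent_map_commutator:
  fixes H :: "'a::unital_cstar_algebra set"
  assumes H: "H \<lhd> unitary_component" and h: "h \<in> H" and L: "bounded_linear L"
  shows "tangent_map H (\<lambda>a. h * L a - L a * h)"
proof -
  define w where "w a = skew_part (L a * h)" for a
  have hh: "star h * h = 1" "h * star h = 1"
    using unitary_component_imp_unitary[OF normal_unitary_facts(1)[OF H h]] by (auto simp: unitaries_def)
  have w: "bounded_linear w" unfolding w_def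
    by (intro bounded_linear_compose[OF bounded_linear_skew_part] bounded_linear_mult_const L)
  have sw: "star (w a) = - w a" for a by (simp add: w_def star_skew_part)
  obtain d where d: "d > 0" "\<And>a. norm a < d \<Longrightarrow> norm (w a) \<le> 1"
    using bounded_linear_small[OF w zero_less_one] by blast
  show ?thesis
  proof (rule tangent_mapI[OF _ _ d(1)])
    show "bounded_linear (\<lambda>a. h * L a - L a * h)"
      by (intro bounded_linear_sub bounded_linear_mult_const bounded_linear_const_mult L)
    have "skew_part (h * L a - L a * h) = h * w a * star h + - w a" for a
    proof -
      have "skew_part (h * L a - L a * h) = skew_part (h * (L a * h) * star h - L a * h)"
        by (simp add: mult.assoc hh(2))
      also have "\<dots> = h * w a * star h - w a"
        by (simp add: linear_diff[OF bounded_linear.linear[OF bounded_linear_skew_part]]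
            skew_part_conj w_def)
      finally show ?thesis by simp
    qed
    moreover have "strict_deriv_at_0 (\<lambda>a. (h * cayley (w a) * star h) * cayley (- w a))
        (\<lambda>a. h * w a * star h + - w a)"
      by (intro strict_deriv_mult strict_deriv_conj strict_deriv_cayley bounded_linear_minus w hh)
    ultimately show "strict_deriv_at_0 (\<lambda>a. (h * cayley (w a) * star h) * cayley (- w a))
        (\<lambda>a. skew_part (h * L a - L a * h))" by simp
    show "(h * cayley (w a) * star h) * cayley (- w a) \<in> H" if "norm a < d" for a
    proof -
      have c: "cayley (w a) \<in> carrier unitary_component" "star (cayley (w a)) = cayley (- w a)"
        using cayley_in_unitary_component[OF d(2)[OF that] sw] cayley_unitary(1)[OF _ sw] d(2)[OF that]
        by simp_all
      have "h * (cayley (w a) * star h * star (cayley (w a))) \<in> H"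
        using normal_unitary_facts[OF H] h c(1) by metis
      then show ?thesis by (simp add: c(2) mult.assoc)
    qed
  qed
qed

text \<open>
Let \<open>B\<close> be the set of all \<open>b\<close> that satisfy the conclusion for every \<open>L\<close>. It contains \<open>H\<close>, and it is
closed under products because \<open>x y l - l x y = (x (y l) - (y l) x) + (y (l x) - (l x) y)\<close>. Hence it is a
closed subalgebra normalised by the unitary component, and it contains a noncentral self-adjoint
element: the real or the imaginary part of a noncentral element of \<open>H\<close>.
\<close>
lemma approx_tangent_map_commutator:
  fixes H :: "'a::unital_cstar_algebra set"
  assumes simple: "simple_cstar_algebra TYPE('a)"
    and H: "H \<lhd> unitary_component" and nc: "\<not> H \<subseteq> group_center unitary_component"
    and L: "bounded_linear L"
  shows "approx_tangent_map H (\<lambda>a. b * L a - L a * b)"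
proof -
  note HD = normal_unitary_facts[OF H]
  define B where "B = {b. \<forall>L. bounded_linear L \<longrightarrow> approx_tangent_map H (\<lambda>a. b * L a - L a * b)}"
  have BD: "approx_tangent_map H (\<lambda>a. b * L a - L a * b)" if "b \<in> B" "bounded_linear L" for b L
    using that by (simp add: B_def)
  have HB: "h \<in> B" if "h \<in> H" for h
    using tangent_map_commutator[OF H that] by (auto simp: B_def intro: tangent_map_imp_approx)
  have add: "x + y \<in> B" if "x \<in> B" "y \<in> B" for x y
    unfolding B_def
  proof (intro CollectI allI impI)
    fix L :: "'a \<Rightarrow> 'a" assume L: "bounded_linear L"
    from approx_tangent_map_add[OF BD[OF that(1) L] BD[OF that(2) L] HD(3)]
    show "approx_tangent_map H (\<lambda>a. (x + y) * L a - L a * (x + y))" by (simp add: algebra_simps)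
  qed
  have scale: "c *\<^sub>C x \<in> B" if "x \<in> B" for c x
    unfolding B_def
  proof (intro CollectI allI impI)
    fix L :: "'a \<Rightarrow> 'a" assume L: "bounded_linear L"
    have "bounded_linear (\<lambda>a. c *\<^sub>C L a)" by (rule bounded_linear_compose[OF bounded_linear_scaleC L])
    from BD[OF that this] show "approx_tangent_map H (\<lambda>a. c *\<^sub>C x * L a - L a * c *\<^sub>C x)"
      by (simp add: mult_scaleC_left mult_scaleC_right)
  qed
  have mult: "x * y \<in> B" if "x \<in> B" "y \<in> B" for x y
    unfolding B_def
  proof (intro CollectI allI impI)
    fix L :: "'a \<Rightarrow> 'a" assume L: "bounded_linear L"
    have "bounded_linear (\<lambda>a. y * L a)" "bounded_linear (\<lambda>a. L a * x)"
      by (intro bounded_linear_mult_const bounded_linear_const_mult L)+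
    from approx_tangent_map_add[OF BD[OF that(1) this(1)] BD[OF that(2) this(2)] HD(3)]
    show "approx_tangent_map H (\<lambda>a. x * y * L a - L a * (x * y))" by (simp add: algebra_simps)
  qed
  have invar: "u * x * star u \<in> B" if u: "u \<in> carrier unitary_component" and x: "x \<in> B" for u x
    unfolding B_def
  proof (intro CollectI allI impI)
    fix L :: "'a \<Rightarrow> 'a" assume L: "bounded_linear L"
    have uu: "u \<in> unitaries" by (rule unitary_component_imp_unitary[OF u])
    have "bounded_linear (\<lambda>a. star u * L a * u)" by (rule bounded_linear_conj[OF L])
    from approx_tangent_map_conj[OF BD[OF x this] uu HD(5)[OF u]]
    show "approx_tangent_map H (\<lambda>a. u * x * star u * L a - L a * (u * x * star u))"
      by (simp add: left_diff_distrib right_diff_distrib mult.assoc unitary_group_simps[OF uu])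
  qed
  have cl: "closed B"
  proof -
    have "x \<in> B" if x: "\<And>e. e > 0 \<Longrightarrow> \<exists>y\<in>B. dist y x < e" for x
      unfolding B_def
    proof (intro CollectI allI impI)
      fix L :: "'a \<Rightarrow> 'a" assume L: "bounded_linear L"
      obtain K where K: "K > 0" "\<And>a. norm (L a) \<le> norm a * K"
        using bounded_linear.pos_bounded[OF L] by blast
      show "approx_tangent_map H (\<lambda>a. x * L a - L a * x)"
      proof (rule approx_tangent_map_closed)
        show "bounded_linear (\<lambda>a. x * L a - L a * x)"
          by (intro bounded_linear_sub bounded_linear_mult_const bounded_linear_const_mult L)
        fix e :: real assume "e > 0"
        then obtain y where y: "y \<in> B" "dist y x < e / (2 * K)" using x[of "e / (2 * K)"] K(1) by auto
        have "norm (x * L a - L a * x - (y * L a - L a * y)) \<le> e * norm a" for a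
        proof -
          have "x * L a - L a * x - (y * L a - L a * y) = (x - y) * L a - L a * (x - y)"
            by (simp add: algebra_simps)
          also have "norm \<dots> \<le> norm (x - y) * norm (L a) + norm (L a) * norm (x - y)"
            by (intro order_trans[OF norm_triangle_ineq4] add_mono norm_mult_ineq)
          also have "\<dots> = 2 * norm (x - y) * norm (L a)" by simp
          also have "\<dots> \<le> 2 * (e / (2 * K)) * (norm a * K)"
            using K(2)[of a] y(2) by (intro mult_mono)
                (auto simp: dist_norm norm_minus_commute less_imp_le[OF \<open>e > 0\<close>] less_imp_le[OF K(1)])
          also have "\<dots> = e * norm a" using K(1) by simp
          finally show ?thesis .
        qed
        with BD[OF y(1) L]
        show "\<exists>M. approx_tangent_map H M \<and> (\<forall>a. norm (x * L a - L a * x - M a) \<le> e * norm a)"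
          by blast
      qed
    qed
    then show ?thesis
      by (metis closed_closure closure_approachable closure_subset subsetI subset_antisym)
  qed
  obtain h g where h: "h \<in> H" and hg: "h * g \<noteq> g * h"
    using nc HD(1) by (auto simp: group_center_def unitary_component_simps)
  define s where "s = h + star h"
  \<comment> \<open>Up to the factor \<open>2\<close> these are the real part of \<open>h\<close> and minus its imaginary part.\<close>
  define t where "t = \<i> *\<^sub>C h + (- \<i>) *\<^sub>C star h"
  have st: "s \<in> B" "star s = s" "t \<in> B" "star t = t"
    using HB[OF h] HB[OF HD(2)[OF h]] add scale
    by (simp_all add: s_def t_def star_add star_scaleC star_star add.commute)
  have "2 *\<^sub>R h = s + (- \<i>) *\<^sub>C t"
    by (simp add: s_def t_def scaleC_add_right scaleC_scaleC scaleC_one scaleR_2 scaleC_minus_left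
        scaleC_diff_right)
  then have "(2 *\<^sub>R h) * g - g * (2 *\<^sub>R h)
      = (s + (- \<i>) *\<^sub>C t) * g - g * (s + (- \<i>) *\<^sub>C t)" by (simp only:)
  also have "\<dots> = (s * g - g * s) + (- \<i>) *\<^sub>C (t * g - g * t)"
    by (simp add: distrib_left distrib_right mult_scaleC_left mult_scaleC_right
        scaleC_diff_right)
  finally have "2 *\<^sub>R (h * g - g * h) = (s * g - g * s) + (- \<i>) *\<^sub>C (t * g - g * t)"
    by (simp add: scaleR_right_diff_distrib)
  then have "s * g \<noteq> g * s \<or> t * g \<noteq> g * t"
    using hg by (auto simp: scaleC_zero_right)
  then have "B = UNIV"
    using invariant_subalgebra_eq_UNIV[OF simple cl add scale mult invar] st by metis
  with BD[OF _ L] show ?thesis by simp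
qed

section \<open>From tangent maps to a neighbourhood of the identity\<close>

text \<open>
For a unitary with self-adjoint part \<open>r\<close> and skew part \<open>s\<close> one has \<open>r r = 1 + s s\<close>, and near \<open>1\<close> the
square root \<open>r\<close> is unique. So close to the identity the skew part is a chart for the unitaries.
\<close>
lemma unitary_eq_if_skew_part_eq:
  fixes u v :: "'a::unital_cstar_algebra"
  assumes u: "u \<in> unitaries" "norm (u - 1) < 1" and v: "v \<in> unitaries" "norm (v - 1) < 1"
    and eq: "skew_part u = skew_part v"
  shows "u = v"
proof -
  define herm where "herm x = x - skew_part x" for x :: 'a
  have herm2: "2 *\<^sub>R herm x = x + star x" for x
    by (simp add: herm_def skew_part_def scaleR_right_diff_distrib) (simp add: scaleR_2)
  then have herm_alt: "herm x = (1/2) *\<^sub>R (x + star x)" for x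
    by (simp flip: herm2)
  have sq: "herm x * herm x = 1 + skew_part x * skew_part x" if "x \<in> unitaries" for x
  proof -
    have "(x + star x) * (x + star x) - (x - star x) * (x - star x) = 2 *\<^sub>R (x * star x) + 2 *\<^sub>R (star x * x)"
      by (simp add: algebra_simps scaleR_2)
    also have "\<dots> = 4 *\<^sub>R 1" using that by (simp add: unitaries_def flip: scaleR_left_distrib)
    finally have "(1/4) *\<^sub>R ((x + star x) * (x + star x) - (x - star x) * (x - star x)) = 1" by simp
    then have "herm x * herm x - skew_part x * skew_part x = 1"
      by (simp only: herm_alt skew_part_def mult_scaleR_left mult_scaleR_right scaleR_scaleR
          flip: scaleR_right_diff_distrib) simp
    then show ?thesis by (simp add: algebra_simps)
  qed
  have small: "norm (herm x - 1) < 1" if "norm (x - 1) < 1" for x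
  proof -
    have "2 *\<^sub>R (herm x - 1) = 2 *\<^sub>R herm x - 2 *\<^sub>R 1" by (rule scaleR_right_diff_distrib)
    also have "\<dots> = x + star x - (1 + 1)" by (simp only: herm2) (simp add: scaleR_2)
    also have "\<dots> = (x - 1) + star (x - 1)" by (simp add: star_diff star_one)
    finally have "2 * norm (herm x - 1) = norm ((x - 1) + star (x - 1))"
      by (metis norm_scaleR abs_numeral)
    also have "\<dots> \<le> 2 * norm (x - 1)"
      using norm_triangle_ineq[of "x - 1" "star (x - 1)"] by (simp add: norm_star)
    finally show ?thesis using that by simp
  qed
  define \<rho> \<sigma> where "\<rho> = herm u - 1" and "\<sigma> = herm v - 1"
  have rs: "norm \<rho> < 1" "norm \<sigma> < 1" using small u v by (simp_all add: \<rho>_def \<sigma>_def)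
  have "herm u * herm u - herm v * herm v = 0"
    by (simp only: sq[OF u(1)] sq[OF v(1)] eq diff_self)
  moreover have "2 *\<^sub>R (\<rho> - \<sigma>) + (\<rho> * (\<rho> - \<sigma>) + (\<rho> - \<sigma>) * \<sigma>) = herm u * herm u - herm v * herm v"
    unfolding \<rho>_def \<sigma>_def by (simp add: algebra_simps scaleR_2)
  ultimately have "2 *\<^sub>R (\<rho> - \<sigma>) = - (\<rho> * (\<rho> - \<sigma>) + (\<rho> - \<sigma>) * \<sigma>)"
    by (simp only: eq_neg_iff_add_eq_0)
  then have "2 * norm (\<rho> - \<sigma>) = norm (\<rho> * (\<rho> - \<sigma>) + (\<rho> - \<sigma>) * \<sigma>)"
    by (metis norm_minus_cancel norm_scaleR abs_numeral)
  also have "\<dots> \<le> norm \<rho> * norm (\<rho> - \<sigma>) + norm (\<rho> - \<sigma>) * norm \<sigma>"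
    by (intro order_trans[OF norm_triangle_ineq] add_mono norm_mult_ineq)
  finally have "norm (\<rho> - \<sigma>) * (2 - norm \<rho> - norm \<sigma>) \<le> 0" by (simp add: algebra_simps)
  moreover have "2 - norm \<rho> - norm \<sigma> > 0" using rs by simp
  ultimately have "norm (\<rho> - \<sigma>) \<le> 0" by (simp add: mult_le_0_iff)
  then have "herm u = herm v" by (simp add: \<rho>_def \<sigma>_def)
  then show "u = v" using eq by (simp add: herm_def)
qed

text \<open>
Let \<open>f\<close> be a map into \<open>K\<close> whose derivative is within \<open>1/2\<close> of the identity on skew-adjoint elements.
For \<open>u\<close> close to \<open>1\<close>, the map \<open>a \<mapsto> a + skew_part (u - f a)\<close> contracts a small ball of skew-adjoint
elements by the factor \<open>3/4 = 1/2 + 1/4\<close>, where \<open>1/4\<close> is the allowed error of strict differentiability. At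
the fixed point \<open>u\<close> and \<open>f a\<close> have the same skew part, so they are equal. No limit of elements of \<open>K\<close>
is taken, which is why \<open>K\<close> need not be closed.
\<close>
lemma neighbourhood_of_identity_tangent:
  fixes K :: "'a::unital_cstar_algebra set"
  assumes tan: "approx_tangent_map K (\<lambda>a. a)" and K: "K \<subseteq> unitaries"
  obtains d where "d > 0" "\<And>u. u \<in> unitaries \<Longrightarrow> norm (u - 1) < d \<Longrightarrow> u \<in> K"
proof -
  have half: "(1/2::real) > 0" and quarter: "(1/4::real) > 0" by simp_all
  obtain M where M: "tangent_map K M" "\<And>a. norm (a - M a) \<le> 1/2 * norm a"
    using tan half unfolding approx_tangent_map_def by blast
  obtain f d1 where f: "bounded_linear M" "strict_deriv_at_0 f (\<lambda>a. skew_part (M a))"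
    "d1 > 0" "\<And>a. norm a < d1 \<Longrightarrow> f a \<in> K"
    using M(1) unfolding tangent_map_def by blast
  obtain d2 where d2: "d2 > 0" "\<And>x y. norm x < d2 \<Longrightarrow> norm y < d2 \<Longrightarrow>
      norm (f x - f y - skew_part (M (x - y))) \<le> 1/4 * norm (x - y)"
    using strict_derivD[OF f(2) quarter] by blast
  obtain d3 where d3: "d3 > 0" "\<And>x. norm x < d3 \<Longrightarrow> norm (f x - 1) \<le> 1/2"
    using strict_deriv_near_1[OF f(2) half] by blast
  define r where "r = min d1 (min d2 d3) / 2"
  have r: "r > 0" "r < d1" "r < d2" "r < d3" using f(3) d2(1) d3(1) by (auto simp: r_def)
  define S where "S = {a::'a. star a = - a} \<inter> cball 0 r"
  have "closed {a::'a. star a = - a}"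
    by (intro closed_Collect_eq continuous_on_star continuous_on_minus continuous_on_id)
  then have S: "complete S" by (simp add: S_def closed_Int complete_eq_closed)
  have S0: "0 \<in> S" using r by (simp add: S_def star_zero)
  have f0: "f 0 = 1" using f(2) by (simp add: strict_deriv_at_0_def)
  have lin: "linear (skew_part :: 'a \<Rightarrow> 'a)"
    by (rule bounded_linear.linear[OF bounded_linear_skew_part])
  have E: "norm (x - y - skew_part (f x - f y)) \<le> 3/4 * norm (x - y)" if "x \<in> S" "y \<in> S" for x y
  proof -
    have xy: "norm x < d2" "norm y < d2" using that r by (auto simp: S_def)
    have sk: "skew_part (x - y) = x - y" using that by (intro skew_part_skew) (simp add: S_def star_diff)
    let ?m = "skew_part (M (x - y))"
    have "skew_part ((x - y) - M (x - y)) = (x - y) - ?m"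
      by (simp only: linear_diff[OF lin, of "x - y"] sk)
    moreover have "skew_part (f x - f y - ?m) = skew_part (f x - f y) - ?m"
      by (simp only: linear_diff[OF lin, of "f x - f y"] skew_part_skew[OF star_skew_part])
    ultimately have "x - y - skew_part (f x - f y)
        = skew_part ((x - y) - M (x - y)) - skew_part (f x - f y - ?m)"
      by simp
    also have "norm \<dots> \<le> norm ((x - y) - M (x - y)) + norm (f x - f y - ?m)"
      by (intro order_trans[OF norm_triangle_ineq4] add_mono norm_skew_part_le)
    also have "\<dots> \<le> 3/4 * norm (x - y)" using M(2)[of "x - y"] d2(2)[OF xy] by linarith
    finally show ?thesis .
  qed
  have "u \<in> K" if u: "u \<in> unitaries" "norm (u - 1) < min 1 (r / 4)" for u
  proof -
    define T where "T a = a + skew_part (u - f a)" for a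
    have TS: "T ` S \<subseteq> S"
    proof (rule image_subsetI)
      fix a assume a: "a \<in> S"
      have Ta: "T a = (a - 0 - skew_part (f a - f 0)) + skew_part (u - 1)"
        by (simp add: T_def f0 linear_diff[OF lin])
      have "norm (T a) \<le> 3/4 * norm (a - 0) + norm (u - 1)"
        using norm_triangle_ineq[of "a - 0 - skew_part (f a - f 0)" "skew_part (u - 1)"]
          E[OF a S0] norm_skew_part_le[of "u - 1"] unfolding Ta by linarith
      also have "\<dots> \<le> r" using a u by (simp add: S_def)
      finally have "norm (T a) \<le> r" .
      moreover have "star (T a) = - T a"
        using a by (simp add: S_def T_def star_add star_skew_part)
      ultimately show "T a \<in> S" by (simp add: S_def)
    qed
    have lip: "dist (T x) (T y) \<le> 3/4 * dist x y" if "x \<in> S" "y \<in> S" for x y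
    proof -
      have "T x - T y = x - y - skew_part (f x - f y)" by (simp add: T_def linear_diff[OF lin])
      then show ?thesis using E[OF that] by (simp add: dist_norm)
    qed
    have "S \<noteq> {}" using S0 by blast
    then have "\<exists>!a\<in>S. T a = a"
      by (rule Banach_fix[OF S _ _ _ TS lip]) simp_all
    then obtain a where a: "a \<in> S" "T a = a" by blast
    then have na: "norm a \<le> r" by (simp add: S_def)
    then have fa: "f a \<in> K" "norm (f a - 1) \<le> 1/2" using f(4) d3(2) r by auto
    from a(2) have "skew_part u = skew_part (f a)" by (simp add: T_def linear_diff[OF lin])
    then have "u = f a"
      using unitary_eq_if_skew_part_eq[of u "f a"] u fa K by auto
    with fa show ?thesis by simp
  qed
  then show thesis using that[of "min 1 (r / 4)"] r by auto
qed

text \<open>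
Left multiplication by a unitary is isometric, so every coset of \<open>K\<close> contains a neighbourhood of each of its
points. Hence \<open>K\<close> and its complement are both relatively open in the connected group.
\<close>
lemma open_subgroup_eq_unitary_component:
  fixes K :: "'a::unital_cstar_algebra set"
  assumes K: "subgroup K unitary_component"
    and d: "d > 0" "\<And>u. u \<in> unitaries \<Longrightarrow> norm (u - 1) < d \<Longrightarrow> u \<in> K"
  shows "K = carrier unitary_component"
proof -
  let ?C = "carrier (unitary_component :: 'a monoid)"
  have KC: "K \<subseteq> ?C" by (rule subgroup.subset[OF K])
  have near: "g \<in> K" if k: "k \<in> K" and g: "g \<in> ?C" and "dist k g < d" for k g
  proof -
    have ku: "k \<in> unitaries" and gu: "g \<in> unitaries"
      using unitary_component_imp_unitary k g KC by auto
    have su: "star k \<in> unitaries" using ku by (simp add: unitaries_def star_star)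
    have "star k * g - 1 = star k * (g - k)"
      by (simp add: right_diff_distrib unitary_group_simps[OF ku])
    then have "norm (star k * g - 1) \<le> norm (star k) * norm (g - k)"
      by (metis norm_mult_ineq)
    then have "norm (star k * g - 1) < d"
      using that(3) by (simp add: norm_unitary[OF su] dist_norm norm_minus_commute)
    then have "star k * g \<in> K" using d(2) unitaries_mult[OF su gu] by blast
    then have "k * (star k * g) \<in> K"
      using subgroup.m_closed[OF K k] by (simp add: unitary_component_simps)
    then show ?thesis by (simp add: unitary_group_simps[OF ku])
  qed
  define U where "U = (\<Union>k\<in>K. ball k d)"
  define V where "V = (\<Union>g\<in>?C - K. ball g d)"
  have disj: "U \<inter> V \<inter> ?C = {}"
  proof -
    have False if x: "x \<in> U" "x \<in> V" "x \<in> ?C" for x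
    proof -
      from x(1,2) obtain k g where kg: "k \<in> K" "dist k x < d" "g \<in> ?C" "g \<notin> K" "dist g x < d"
        unfolding U_def V_def by auto
      have "x \<in> K" by (rule near[OF kg(1) x(3) kg(2)])
      then have "g \<in> K" using kg(5) by (intro near[OF _ kg(3)]) (simp_all add: dist_commute)
      with kg(4) show False by simp
    qed
    then show ?thesis by blast
  qed
  have cover: "?C \<subseteq> U \<union> V"
  proof
    fix g assume "g \<in> ?C"
    moreover have "g \<in> ball g d" using d(1) by simp
    ultimately show "g \<in> U \<union> V" unfolding U_def V_def by blast
  qed
  have conn: "connected ?C" by (simp add: unitary_component_simps connected_connected_component)
  have op: "open U" "open V" by (auto simp: U_def V_def)
  have "U \<inter> ?C = {} \<or> V \<inter> ?C = {}" by (rule connectedD[OF conn op disj cover])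
  moreover have "1 \<in> U \<inter> ?C"
  proof -
    have "1 \<in> K" using subgroup.one_closed[OF K] by (simp add: unitary_component_simps)
    moreover have "1 \<in> ball (1::'a) d" using d(1) by simp
    ultimately show ?thesis using KC unfolding U_def by blast
  qed
  ultimately have "V \<inter> ?C = {}" by blast
  moreover have "g \<in> V" if "g \<in> ?C - K" for g
    using that d(1) centre_in_ball[of g d] unfolding V_def by blast
  ultimately show ?thesis using KC by blast
qed

section \<open>Unitaries of a corner\<close>

definition unitaries_fixing :: "'a::unital_cstar_algebra \<Rightarrow> 'a set" where
  "unitaries_fixing p = {u \<in> carrier unitary_component. u * p = p \<and> p * u = p}"

lemma subgroup_unitaries_fixing: "subgroup (unitaries_fixing p) unitary_component"
proof (rule group.subgroupI[OF group_unitary_component])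
  show "unitaries_fixing p \<noteq> {}"
  proof -
    have "1 \<in> unitaries_fixing p"
      using one_in_unitary_component by (simp add: unitaries_fixing_def unitary_component_simps)
    then show ?thesis by blast
  qed
  fix u assume u: "u \<in> unitaries_fixing p"
  then have uu: "u \<in> unitaries" by (simp add: unitaries_fixing_def unitary_component_imp_unitary)
  have up: "u * p = p" "p * u = p" using u by (simp_all add: unitaries_fixing_def)
  have "star u * (u * p) = p" by (rule unitary_group_simps(3)[OF uu])
  moreover have "(p * u) * star u = p" by (simp add: mult.assoc unitary_group_simps(2)[OF uu])
  ultimately have "star u * p = p" "p * star u = p" by (simp_all only: up)
  with u show "inv\<^bsub>unitary_component\<^esub> u \<in> unitaries_fixing p"
    by (simp add: unitaries_fixing_def inv_unitary_component)
       (simp add: unitary_component_simps star_in_unitary_component)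
next
  fix u v assume "u \<in> unitaries_fixing p" "v \<in> unitaries_fixing p"
  then show "u \<otimes>\<^bsub>unitary_component\<^esub> v \<in> unitaries_fixing p"
    by (auto simp: unitaries_fixing_def unitary_component_simps mult_in_unitary_component mult.assoc)
       (simp flip: mult.assoc)
qed (auto simp: unitaries_fixing_def)

text \<open>
The Cayley transform of an element \<open>w\<close> with \<open>p w = w p = 0\<close> acts as the identity on \<open>p\<close>.
\<close>
lemma tangent_map_unitaries_fixing:
  fixes p :: "'a::unital_cstar_algebra"
  assumes L: "bounded_linear L" and p: "projection p" "\<And>a. p * L a = 0" "\<And>a. L a * p = 0"
  shows "tangent_map (unitaries_fixing p) L"
proof -
  define w where "w a = skew_part (L a)" for a
  have w: "bounded_linear w" unfolding w_def by (rule bounded_linear_compose[OF bounded_linear_skew_part L])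
  have sp: "star p = p" using p(1) by (simp add: projection_def)
  have "star (L a) * p = 0" "p * star (L a) = 0" for a
    using p(2,3)[of a] by (metis sp star_mult star_zero)+
  then have wp: "w a * p = 0" "p * w a = 0" for a
    using p(2,3)[of a] by (simp_all add: w_def skew_part_def left_diff_distrib right_diff_distrib)
  obtain d where d: "d > 0" "\<And>a. norm a < d \<Longrightarrow> norm (w a) \<le> 1"
    using bounded_linear_small[OF w zero_less_one] by blast
  show ?thesis
  proof (rule tangent_mapI[OF L _ d(1)])
    show "strict_deriv_at_0 (\<lambda>a. cayley (w a)) (\<lambda>a. skew_part (L a))"
      using strict_deriv_cayley[OF w] unfolding w_def .
    show "cayley (w a) \<in> unitaries_fixing p" if "norm a < d" for a
    proof -
      have n: "norm (w a) < 2" using d(2)[OF that] by simp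
      have "resolvent (w a) * p = resolvent (w a) * ((1 - (1/2) *\<^sub>R w a) * p)"
        by (simp add: left_diff_distrib wp)
      then have 1: "resolvent (w a) * p = p"
        by (simp only: mult.assoc[symmetric] resolvent_inverse(2)[OF n] mult_1_left)
      have "p * resolvent (w a) = (p * (1 - (1/2) *\<^sub>R w a)) * resolvent (w a)"
        by (simp add: right_diff_distrib wp)
      then have 2: "p * resolvent (w a) = p"
        by (simp only: mult.assoc resolvent_inverse(1)[OF n] mult_1_right)
      have "cayley (w a) \<in> carrier unitary_component"
        using d(2)[OF that] by (rule cayley_in_unitary_component) (simp add: w_def star_skew_part)
      moreover have "2 *\<^sub>R p - p = p" by (simp add: scaleR_2)
      ultimately show ?thesis
        by (simp add: unitaries_fixing_def cayley_def left_diff_distrib right_diff_distrib 1 2)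
    qed
  qed
qed

text \<open>
Cut \<open>a\<close> into corners with respect to \<open>p\<close> and \<open>q = 1 - p\<close>. The corner \<open>q a q\<close> is covered by assumption,
and \<open>p a q + q a p\<close> is the commutator of \<open>p\<close> with \<open>p a q - q a p\<close>. For \<open>p a p\<close>, consider the set \<open>I\<close> of all
\<open>z\<close> such that \<open>a \<mapsto> p a x z y p\<close> is an approximate tangent map for all \<open>x\<close> and \<open>y\<close>. It is a closed ideal.
It contains \<open>q\<close>, since \<open>(p a x q) (q y p)\<close> differs from a commutator by an element of the corner of \<open>q\<close>.
By simplicity it contains \<open>1\<close>.
\<close>
lemma approx_tangent_map_identity:
  fixes p :: "'a::unital_cstar_algebra"
  assumes simple: "simple_cstar_algebra TYPE('a)" and p: "projection p" "p \<noteq> 1"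
    and comm: "\<And>b L. bounded_linear L \<Longrightarrow> approx_tangent_map K (\<lambda>a. b * L a - L a * b)"
    and corner: "\<And>L. bounded_linear L \<Longrightarrow> (\<And>a. p * L a = 0) \<Longrightarrow> (\<And>a. L a * p = 0) \<Longrightarrow>
                   approx_tangent_map K L"
    and K: "\<And>u v. u \<in> K \<Longrightarrow> v \<in> K \<Longrightarrow> u * v \<in> K"
  shows "approx_tangent_map K (\<lambda>a. a)"
proof -
  define q where "q = 1 - p"
  have pp: "p * p = p" "p * (p * x) = p * x" for x
    using p(1) by (simp_all add: projection_def flip: mult.assoc)
  have q0: "q \<noteq> 0" using p(2) by (simp add: q_def)
  have qq: "p * q = 0" "q * p = 0" "p * (q * x) = 0" "q * (p * x) = 0" "q * q = q"
    "q * (q * x) = q * x" for x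
    by (simp_all add: q_def left_diff_distrib right_diff_distrib pp)
  note bl = bounded_linear_mult_const bounded_linear_const_mult bounded_linear_ident
    bounded_linear_add bounded_linear_sub
  define I where "I = {z. \<forall>x y. approx_tangent_map K (\<lambda>a. p * a * x * z * y * p)}"
  have "closed_two_sided_ideal I"
    unfolding closed_two_sided_ideal_def
  proof (intro conjI ballI allI)
    have zero: "approx_tangent_map K (\<lambda>a. 0)"
      by (rule corner) auto
    then show "0 \<in> I" by (simp add: I_def)
    show "z + z' \<in> I" if "z \<in> I" "z' \<in> I" for z z'
    proof -
      have "approx_tangent_map K (\<lambda>a. p * a * x * z * y * p + p * a * x * z' * y * p)" for x y
        using that by (intro approx_tangent_map_add K) (auto simp: I_def)
      then show ?thesis by (simp add: I_def algebra_simps)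
    qed
    show "c *\<^sub>C z \<in> I" if z: "z \<in> I" for c z
    proof -
      have "approx_tangent_map K (\<lambda>a. p * a * (c *\<^sub>C x) * z * y * p)" for x y
        using z unfolding I_def by blast
      then show ?thesis by (simp add: I_def mult_scaleC_left mult_scaleC_right)
    qed
    show "r * z \<in> I" if z: "z \<in> I" for r z
    proof -
      have "approx_tangent_map K (\<lambda>a. p * a * (x * r) * z * y * p)" for x y
        using z unfolding I_def by blast
      then show ?thesis by (simp add: I_def mult.assoc)
    qed
    show "z * r \<in> I" if z: "z \<in> I" for r z
    proof -
      have "approx_tangent_map K (\<lambda>a. p * a * x * z * (r * y) * p)" for x y
        using z unfolding I_def by blast
      then show ?thesis by (simp add: I_def mult.assoc)
    qed
    have "z \<in> I" if z: "\<And>e. e > 0 \<Longrightarrow> \<exists>z'\<in>I. dist z' z < e" for z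
      unfolding I_def
    proof (intro CollectI allI)
      fix x y
      show "approx_tangent_map K (\<lambda>a. p * a * x * z * y * p)"
      proof (rule approx_tangent_map_closed)
        show "bounded_linear (\<lambda>a. p * a * x * z * y * p)" by (intro bl)
        fix e :: real assume e: "e > 0"
        define C where "C = norm p * norm x * norm y * norm p + 1"
        have C: "C > 0" by (simp add: C_def add_nonneg_pos)
        obtain z' where z': "z' \<in> I" "dist z' z < e / C" using z[of "e / C"] e C by auto
        have "norm (p * a * x * z * y * p - p * a * x * z' * y * p) \<le> e * norm a" for a
        proof -
          have "p * a * x * z * y * p - p * a * x * z' * y * p = p * a * x * (z - z') * y * p"
            by (simp add: algebra_simps)
          also have "norm \<dots> \<le> norm p * norm a * norm x * norm (z - z') * norm y * norm p"
            by (intro order_trans[OF norm_mult_ineq] mult_right_mono norm_mult_ineq) auto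
          also have "\<dots> = (norm p * norm x * norm y * norm p) * norm (z - z') * norm a" by simp
          also have "\<dots> \<le> C * (e / C) * norm a"
            using z'(2) C by (intro mult_right_mono mult_mono)
              (auto simp: C_def dist_norm norm_minus_commute)
          also have "\<dots> = e * norm a" using C by simp
          finally show ?thesis .
        qed
        moreover have "approx_tangent_map K (\<lambda>a. p * a * x * z' * y * p)"
          using z'(1) by (simp add: I_def)
        ultimately show "\<exists>M. approx_tangent_map K M \<and>
            (\<forall>a. norm (p * a * x * z * y * p - M a) \<le> e * norm a)"
          by blast
      qed
    qed
    then show "closed I"
      by (metis closed_closure closure_approachable closure_subset subsetI subset_antisym)
  qed
  then consider "I = {0}" | "I = UNIV" using simple unfolding simple_cstar_algebra_def by blast
  then have "1 \<in> I"
  proof cases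
    case 1
    have "q \<in> I"
      unfolding I_def
    proof (intro CollectI allI)
      fix x y
      have "approx_tangent_map K (\<lambda>a. (- (q * y * p)) * (p * a * x * q) - (p * a * x * q) * (- (q * y * p)))"
        by (rule comm[of "\<lambda>a. p * a * x * q" "- (q * y * p)"]) (intro bl)
      moreover have "approx_tangent_map K (\<lambda>a. q * y * p * (p * a * x * q))"
        by (intro corner bl) (simp_all add: mult.assoc qq)
      ultimately have "approx_tangent_map K (\<lambda>a.
          ((- (q * y * p)) * (p * a * x * q) - (p * a * x * q) * (- (q * y * p)))
            + q * y * p * (p * a * x * q))"
        by (intro approx_tangent_map_add K)
      then show "approx_tangent_map K (\<lambda>a. p * a * x * q * y * p)"
        by (simp add: mult.assoc qq)
    qed
    with 1 q0 show ?thesis by simp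
  qed simp
  then have "approx_tangent_map K (\<lambda>a. p * a * 1 * 1 * 1 * p)" unfolding I_def by blast
  then have "approx_tangent_map K (\<lambda>a. p * a * p)" by simp
  moreover have "approx_tangent_map K (\<lambda>a. p * (p * a * q - q * a * p) - (p * a * q - q * a * p) * p)"
    by (rule comm[of "\<lambda>a. p * a * q - q * a * p" p]) (intro bl)
  moreover have "approx_tangent_map K (\<lambda>a. q * a * q)"
    by (intro corner bl) (simp_all add: mult.assoc qq)
  ultimately have "approx_tangent_map K (\<lambda>a. p * a * p +
      (p * (p * a * q - q * a * p) - (p * a * q - q * a * p) * p) + q * a * q)"
    by (intro approx_tangent_map_add K)
  moreover have "p * a * p + (p * (p * a * q - q * a * p) - (p * a * q - q * a * p) * p) + q * a * q = a" for a
    by (simp add: q_def left_diff_distrib right_diff_distrib mult.assoc pp)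
  ultimately show ?thesis by simp
qed

lemma unitary_component_eq_normal_times_fixing:
  fixes H :: "'a::unital_cstar_algebra set"
  assumes simple: "simple_cstar_algebra TYPE('a)"
    and H: "H \<lhd> unitary_component" and nc: "\<not> H \<subseteq> group_center unitary_component"
    and p: "projection p" "p \<noteq> 1"
  shows "H <#>\<^bsub>unitary_component\<^esub> unitaries_fixing p = carrier unitary_component"
proof -
  let ?Q = "unitaries_fixing p" and ?K = "H <#>\<^bsub>unitary_component\<^esub> unitaries_fixing p"
  have K: "subgroup ?K unitary_component"
    by (rule group.mult_norm_subgroup[OF group_unitary_component H subgroup_unitaries_fixing])
  have prod: "h * x \<in> ?K" if "h \<in> H" "x \<in> ?Q" for h x
    using that unfolding set_mult_def unitary_component_simps by blast
  have "1 \<in> ?Q" using subgroup.one_closed[OF subgroup_unitaries_fixing[of p]]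
    by (simp add: unitary_component_simps)
  then have HK: "H \<subseteq> ?K" using prod[of _ 1] by auto
  have QK: "?Q \<subseteq> ?K" using prod[of 1] normal_unitary_facts(4)[OF H] by auto
  have "approx_tangent_map ?K (\<lambda>a. a)"
  proof (rule approx_tangent_map_identity[OF simple p])
    show "approx_tangent_map ?K (\<lambda>a. b * L a - L a * b)" if "bounded_linear L" for b L
      by (rule approx_tangent_map_mono[OF approx_tangent_map_commutator[OF simple H nc that] HK])
    show "approx_tangent_map ?K L"
      if "bounded_linear L" "\<And>a. p * L a = 0" "\<And>a. L a * p = 0" for L
      by (rule tangent_map_imp_approx[OF
            tangent_map_mono[OF tangent_map_unitaries_fixing[OF that(1) p(1) that(2,3)] QK]])
    show "u * v \<in> ?K" if "u \<in> ?K" "v \<in> ?K" for u v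
      using subgroup.m_closed[OF K that] by (simp add: unitary_component_simps)
  qed
  moreover have "?K \<subseteq> unitaries"
    using subgroup.subset[OF K] unitary_component_imp_unitary by blast
  ultimately obtain d where "d > 0" "\<And>u. u \<in> unitaries \<Longrightarrow> norm (u - 1) < d \<Longrightarrow> u \<in> ?K"
    using neighbourhood_of_identity_tangent by blast
  then show ?thesis by (rule open_subgroup_eq_unitary_component[OF K])
qed

section \<open>The dichotomy\<close>

text \<open>
Multiplication by \<open>p\<close> on either side kills \<open>u - 1\<close> and fixes \<open>v - 1\<close>, so the products of \<open>u - 1\<close> and \<open>v - 1\<close>
vanish.
\<close>
lemma unitaries_fixing_complement_commute:
  assumes "u \<in> unitaries_fixing p" "v \<in> unitaries_fixing (1 - p)"
  shows "u * v = v * u"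
proof -
  have up: "u * p = p" "p * u = p" using assms(1) by (simp_all add: unitaries_fixing_def)
  have "v * (1 - p) = 1 - p" "(1 - p) * v = 1 - p"
    using assms(2) by (simp_all add: unitaries_fixing_def)
  moreover have "(v - 1) * p = (v - 1) - (v * (1 - p) - (1 - p))"
    "p * (v - 1) = (v - 1) - ((1 - p) * v - (1 - p))"
    by (simp_all add: algebra_simps)
  ultimately have vp: "v - 1 = (v - 1) * p" "v - 1 = p * (v - 1)" by simp_all
  have "u * (v - 1) = v - 1" by (metis up(1) vp(2) mult.assoc)
  moreover have "(v - 1) * u = v - 1" by (metis up(2) vp(1) mult.assoc)
  moreover have "u * v = u * (v - 1) + u" "v * u = (v - 1) * u + u" by (simp_all add: algebra_simps)
  ultimately show ?thesis by simp
qed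

text \<open>
Both \<open>P\<close> and \<open>Q\<close> map onto the quotient by \<open>H\<close>. Writing one factor of a product with a representative
from \<open>P\<close> and the other with one from \<open>Q\<close> shows that the quotient is commutative.
\<close>
lemma (in normal) derived_subset_if_commuting_supplements:
  assumes P: "P \<subseteq> carrier G" "H <#> P = carrier G" and Q: "Q \<subseteq> carrier G" "H <#> Q = carrier G"
    and comm: "\<And>x y. x \<in> P \<Longrightarrow> y \<in> Q \<Longrightarrow> x \<otimes> y = y \<otimes> x"
  shows "derived G (carrier G) \<subseteq> H"
  unfolding derived_def
proof (rule generate_subgroup_incl[OF _ subgroup_axioms])
  have "g \<otimes> k \<otimes> inv g \<otimes> inv k \<in> H" if g: "g \<in> carrier G" and k: "k \<in> carrier G" for g k
  proof -
    have "g \<in> H <#> P" "k \<in> H <#> Q" using g k P(2) Q(2) by simp_all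
    then obtain h x h' y where x: "h \<in> H" "x \<in> P" "g = h \<otimes> x" and y: "h' \<in> H" "y \<in> Q" "k = h' \<otimes> y"
      unfolding set_mult_def by blast
    have c: "h \<in> carrier G" "h' \<in> carrier G" "x \<in> carrier G" "y \<in> carrier G"
      using x y P(1) Q(1) by auto
    have gx: "H #> g = H #> x"
      using coset_mult_assoc[OF subset c(1) c(3)] rcos_const[OF is_group x(1)] x(3) by simp
    have ky: "H #> k = H #> y"
      using coset_mult_assoc[OF subset c(2) c(4)] rcos_const[OF is_group y(1)] y(3) by simp
    have "H #> (g \<otimes> k) = (H #> x) <#> (H #> y)" using rcos_sum[OF g k] by (simp only: gx ky)
    also have "\<dots> = (H #> y) <#> (H #> x)"
      using rcos_sum[OF c(3,4)] rcos_sum[OF c(4,3)] comm[OF x(2) y(2)] by simp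
    also have "\<dots> = H #> (k \<otimes> g)" using rcos_sum[OF k g] by (simp only: gx ky)
    finally have "g \<otimes> k \<in> H #> (k \<otimes> g)"
      using rcos_self[OF m_closed[OF g k] subgroup_axioms] by simp
    then have "g \<otimes> k \<otimes> inv (k \<otimes> g) \<in> H"
      by (rule rcos_module_imp[OF is_group m_closed[OF k g]])
    then show ?thesis using g k by (simp add: inv_mult_group m_assoc)
  qed
  then show "derived_set G (carrier G) \<subseteq> H" by auto
qed

theorem corollary6p4:
  fixes H :: "'a::unital_cstar_algebra set"
  assumes "simple_cstar_algebra TYPE('a)"
    and "\<exists>p :: 'a. projection p \<and> p \<noteq> 0 \<and> p \<noteq> 1"
    and "H \<lhd> (unitary_component :: 'a monoid)"
  shows "H \<subseteq> group_center unitary_component \<or>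
         derived unitary_component (carrier unitary_component) \<subseteq> H"
proof (cases "H \<subseteq> group_center unitary_component")
  case nc: False
  obtain p :: 'a where p: "projection p" "p \<noteq> 0" "p \<noteq> 1" using assms(2) by blast
  have q: "projection (1 - p)" "1 - p \<noteq> 1"
    using p by (auto simp: projection_def star_diff star_one algebra_simps)
  have "derived unitary_component (carrier unitary_component) \<subseteq> H"
  proof (rule normal.derived_subset_if_commuting_supplements[OF assms(3)])
    show "H <#>\<^bsub>unitary_component\<^esub> unitaries_fixing p = carrier unitary_component"
      by (rule unitary_component_eq_normal_times_fixing[OF assms(1,3) nc p(1,3)])
    show "H <#>\<^bsub>unitary_component\<^esub> unitaries_fixing (1 - p) = carrier unitary_component"
      by (rule unitary_component_eq_normal_times_fixing[OF assms(1,3) nc q])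
    show "u \<otimes>\<^bsub>unitary_component\<^esub> v = v \<otimes>\<^bsub>unitary_component\<^esub> u"
      if "u \<in> unitaries_fixing p" "v \<in> unitaries_fixing (1 - p)" for u v
      using unitaries_fixing_complement_commute[OF that] by (simp add: unitary_component_simps)
  qed (auto simp: unitaries_fixing_def)
  then show ?thesis by blast
qed simp

end
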